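(* Let $A$ be a complex $m\times n$ matrix and $B$ a complex $r\times s$ matrix satisfying $|A|_\infty=|B|_\infty=1$. Then for every $i=1,\dots,\min(m,n,r,s)$, $$\left|\frac{\sigma_i(A)}{\sqrt{mn}}-\frac{\sigma_i(B)}{\sqrt{rs}}\right|\le6\,\delta_{\boxminus}(A,B)^{1/2}.$$
   Context: $\sigma_1(M)\ge\sigma_2(M)\ge\cdots$ are the singular values of a matrix $M$, and $|M|_\infty$ is the maximum modulus of its entries. For a complex $p\times q$ matrix $M$, the cut-norm is $$\|M\|_\square=\max_{X\subset[p],\,Y\subset[q]}\frac1{pq}\left|\Sigma(M[X,Y])\right|,$$ where $[p]=\{1,\dots,p\}$, $M[X,Y]$ is the submatrix with rows in $X$ and columns in $Y$, and $\Sigma$ denotes the sum of the entries. Cut-distance of arbitrary matrices: for a matrix $M$ and positive integers $p,q$, let $M^{(p,q)}=M\otimes J_{p,q}$ (Kronecker product with the $p\times q$ all-ones matrix). For $M,N$ of the same size $d\times e$, let $$\widehat\delta_{\boxminus}(M,N)=\min\{\|M-PNQ\|_\square : P\text{ a }d\times d\text{ permutation matrix},\ Q\text{ an }e\times e\text{ permutation matrix}\}.$$ For $A$ of size $m\times n$ and $B$ of size $r\times s$, define $$\delta_{\boxminus}(A,B)=\lim_{k\to\infty}\widehat\delta_{\boxminus}\left(A^{(kr,ks)},B^{(km,kn)}\right);$$ this limit exists and equals $\inf_{k\ge1}\widehat\delta_{\boxminus}(A^{(kr,ks)},B^{(km,kn)})$. *)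

theory Defs
  imports
    Complex_Main
    "HOL-Combinatorics.Permutations"
    "HOL-Computational_Algebra.Polynomial"
    "Jordan_Normal_Form.Schur_Decomposition"
    "Jordan_Normal_Form.DL_Submatrix"
begin

text \<open>
  The singular values of \<open>M\<close> are the square roots of the eigenvalues of \<open>M\<^sup>* M\<close>, repeated
  according to multiplicity and listed in non-increasing order. The list has \<open>dim_col M\<close> entries,
  so it ends in extra zeros if \<open>M\<close> has more columns than rows. The eigenvalues are real and
  nonnegative; \<open>Re\<close> only changes the type.
\<close>
definition singular_values :: "complex mat \<Rightarrow> real list" where
  "singular_values M =
     rev (sorted_list_of_multiset
       (image_mset (\<lambda>x. sqrt (Re x)) (proots (char_poly (mat_adjoint M * M)))))"

text \<open>The index is 1-based: \<open>singular_value 1 M\<close> is the largest singular value.\<close>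
definition singular_value :: "nat \<Rightarrow> complex mat \<Rightarrow> real" where
  "singular_value i M = singular_values M ! (i - 1)"

definition max_modulus :: "complex mat \<Rightarrow> real" where
  "max_modulus M = Max (cmod ` elements_mat M)"

definition cut_norm :: "complex mat \<Rightarrow> real" where
  "cut_norm M =
     Max {1 / (real (dim_row M) * real (dim_col M)) * cmod (sum_mat (submatrix M X Y)) | X Y.
            X \<subseteq> {..<dim_row M} \<and> Y \<subseteq> {..<dim_col M}}"

definition kronecker_product :: "'a::times mat \<Rightarrow> 'a mat \<Rightarrow> 'a mat" where
  "kronecker_product M N =
     mat (dim_row M * dim_row N) (dim_col M * dim_col N)
       (\<lambda>(i, j). M $$ (i div dim_row N, j div dim_col N) * N $$ (i mod dim_row N, j mod dim_col N))"

definition all_ones_mat :: "nat \<Rightarrow> nat \<Rightarrow> 'a::one mat" where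
  "all_ones_mat p q = mat p q (\<lambda>_. 1)"

definition blowup :: "complex mat \<Rightarrow> nat \<Rightarrow> nat \<Rightarrow> complex mat" where
  "blowup M p q = kronecker_product M (all_ones_mat p q)"

definition permutation_mats :: "nat \<Rightarrow> complex mat set" where
  "permutation_mats d =
     {mat d d (\<lambda>(i, j). if j = \<pi> i then 1 else 0) | \<pi>. \<pi> permutes {..<d}}"

text \<open>Meaningful only if \<open>M\<close> and \<open>N\<close> have the same dimensions.\<close>
definition cut_distance_same_size :: "complex mat \<Rightarrow> complex mat \<Rightarrow> real" where
  "cut_distance_same_size M N =
     Min {cut_norm (M - P * N * Q) | P Q.
            P \<in> permutation_mats (dim_row M) \<and> Q \<in> permutation_mats (dim_col M)}"

text \<open>
  For \<open>A\<close> of size \<open>m \<times> n\<close> and \<open>B\<close> of size \<open>r \<times> s\<close>, both blow-ups have size \<open>kmr \<times> kns\<close>.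
\<close>
definition cut_distance :: "complex mat \<Rightarrow> complex mat \<Rightarrow> real" where
  "cut_distance A B =
     lim (\<lambda>k. cut_distance_same_size
                (blowup A (k * dim_row B) (k * dim_col B))
                (blowup B (k * dim_row A) (k * dim_col A)))"

end

theory Submission
  imports Defs "HOL-Analysis.L2_Norm"
begin

text \<open>
  All the information that relates \<open>A\<close> and \<open>B\<close> is a coupling: a finite row set \<open>D\<close> with maps
  \<open>a\<close>, \<open>b\<close> to the rows of \<open>A\<close> and of \<open>B\<close>, and a finite column set \<open>F\<close> with maps \<open>a'\<close>, \<open>b'\<close> to
  their columns, all four with fibres of constant size (\<open>equitable\<close>). A pair of permutations
  matching two blow-ups is such a coupling, and conversely every coupling whose fibres have the right
  sizes comes from a pair of permutations (\<open>blowup_distance_attained\<close>, \<open>blowup_distance_le\<close>). The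
  matrix \<open>E x y = A (a x) (a' y) - B (b x) (b' y)\<close> plays the role of \<open>M - P N Q\<close>, and a coupling
  treats \<open>A\<close> and \<open>B\<close> symmetrically.

  Cut norm to operator norm. If every rectangle sum of \<open>E\<close> is at most \<open>C\<close> in modulus and
  \<open>\<bar>E\<bar> \<le> c0\<close>, then the norm of \<open>E\<close> from \<open>\<ell>\<^sup>\<infinity>\<close> to \<open>\<ell>\<^sup>1\<close> is at most \<open>16 C\<close>: a factor 4 for
  the positive and negative real and imaginary parts of the test vector, and a factor 4 for those of
  the image. So every row of the Hermitian matrix \<open>E\<^sup>* E\<close> has absolute sum at most \<open>16 c0 C\<close>, and
  this bounds its operator norm (\<open>rectangle_sums_operator_bound\<close>). With \<open>c0 = 2\<close> the operator norm
  of \<open>E\<close>, divided by the root of the number of entries, is at most \<open>sqrt (32 \<delta>)\<close>, which is below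
  \<open>6 sqrt \<delta>\<close>. Going through \<open>\<ell>\<^sup>\<infinity>\<close> and \<open>\<ell>\<^sup>1\<close>, and not through the trace of \<open>(E\<^sup>* E)\<^sup>2\<close>, is
  what gives the exponent 1/2 and not 1/4.

  Operator norm to singular values. Only singular values of \<open>A\<close> and \<open>B\<close> themselves are compared. A column
  vector \<open>u\<close> for \<open>A\<close> lifts to the function \<open>u \<circ> a'\<close> on \<open>F\<close>, whose sums over the fibres of \<open>b'\<close> form a
  column vector \<open>T u\<close> for \<open>B\<close>; up to the error \<open>E (u \<circ> a')\<close> and explicit factors the norms of \<open>A u\<close>
  and of \<open>B (T u)\<close> agree. The dimension count behind the Courant-Fischer principle turns such a
  comparison into one of singular values (\<open>singular_value_transfer\<close>). It is applied to orthonormal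
  eigenbases, which exist by the spectral theorem (\<open>hermitian_diagonalization\<close>).

  The limit. This gives the bound with the \<open>k\<close>-th blow-up distance \<open>\<delta>\<^sub>k\<close> for every \<open>k \<ge> 1\<close>. To
  pass to the limit, \<open>\<delta>\<^sub>k\<close> must be shown to converge. Placing \<open>k div k0\<close> copies of an optimal
  coupling of level \<open>k0\<close> next to a trivial coupling of level \<open>k mod k0\<close> gives
  \<open>\<delta>\<^sub>k \<le> \<delta>\<^sub>k\<^sub>0 + 4 k0 / k\<close> (\<open>blowup_distance_step\<close>), so \<open>\<delta>\<^sub>k\<close> tends to its infimum.
\<close>

section \<open>Unitary diagonalization of Hermitian matrices\<close>

lemma mat_adjoint_dim [simp]:
  "dim_row (mat_adjoint M) = dim_col M" "dim_col (mat_adjoint M) = dim_row M"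
  by (simp_all add: mat_adjoint_def)

lemma mat_adjoint_carrier [simp]:
  "M \<in> carrier_mat m n \<Longrightarrow> mat_adjoint M \<in> carrier_mat n m"
  unfolding carrier_mat_def by simp

lemma mat_adjoint_index [simp]:
  fixes M :: "complex mat"
  assumes "i < dim_col M" and "j < dim_row M"
  shows "mat_adjoint M $$ (i, j) = cnj (M $$ (j, i))"
  using assms by (simp add: mat_adjoint_def mat_of_rows_index)

lemma mat_adjoint_mult:
  fixes M N :: "complex mat"
  assumes "M \<in> carrier_mat m n" and "N \<in> carrier_mat n p"
  shows "mat_adjoint (M * N) = mat_adjoint N * mat_adjoint M"
  using assms by (intro eq_matI) (auto simp: scalar_prod_def mult.commute intro!: sum.cong)

lemma mat_adjoint_adjoint [simp]:
  fixes M :: "complex mat"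
  shows "mat_adjoint (mat_adjoint M) = M"
  by (intro eq_matI) auto

definition unitary_mat :: "nat \<Rightarrow> complex mat \<Rightarrow> bool" where
  "unitary_mat n U \<longleftrightarrow> U \<in> carrier_mat n n \<and> mat_adjoint U * U = 1\<^sub>m n"

lemma unitary_mat_right:
  assumes "unitary_mat n U"
  shows "U * mat_adjoint U = 1\<^sub>m n"
proof -
  have U: "U \<in> carrier_mat n n" "mat_adjoint U * U = 1\<^sub>m n"
    using assms by (simp_all add: unitary_mat_def)
  show ?thesis
    by (rule mat_mult_left_right_inverse[OF mat_adjoint_carrier[OF U(1)] U])
qed

lemma unitary_mat_mult:
  assumes "unitary_mat n U" and "unitary_mat n V"
  shows "unitary_mat n (U * V)"
proof -
  have U: "U \<in> carrier_mat n n" "mat_adjoint U * U = 1\<^sub>m n"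
    and V: "V \<in> carrier_mat n n" "mat_adjoint V * V = 1\<^sub>m n"
    using assms by (auto simp: unitary_mat_def)
  note C = mat_adjoint_carrier[OF U(1)] mat_adjoint_carrier[OF V(1)] U(1) V(1)
  have "mat_adjoint (U * V) * (U * V) = mat_adjoint V * (mat_adjoint U * (U * V))"
    unfolding mat_adjoint_mult[OF U(1) V(1)]
    by (rule assoc_mult_mat[OF C(2,1) mult_carrier_mat[OF C(3,4)]])
  also have "mat_adjoint U * (U * V) = V"
    using assoc_mult_mat[OF C(1,3,4)] U(2) V(1) by simp
  finally show ?thesis
    using U V by (simp add: unitary_mat_def)
qed

text \<open>
  Extend \<open>v\<close> to a basis, apply the Gram-Schmidt process, which keeps the first vector, and normalize
  the columns.
\<close>
lemma exists_unitary_first_column: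
  fixes v :: "complex vec"
  assumes v: "v \<in> carrier_vec n" "v \<noteq> 0\<^sub>v n"
  obtains U c where "unitary_mat n U" "col U 0 = c \<cdot>\<^sub>v v"
proof -
  have n: "n > 0"
  proof (rule ccontr)
    assume "\<not> n > 0"
    then have "v = 0\<^sub>v n" using v(1) by (intro eq_vecI) simp_all
    then show False using v(2) by contradiction
  qed
  interpret cof_vec_space n "TYPE(complex)" .
  define ws where "ws = gram_schmidt n (basis_completion v)"
  note b = basis_completion[OF v]
  have ws: "set ws \<subseteq> carrier_vec n" "corthogonal ws" "length ws = n"
    using gram_schmidt_result[OF b(2) b(4) b(5) ws_def] b(6) by simp_all
  obtain vs where "basis_completion v = v # vs"
    using b(6,7) n by (metis hd_Cons_tl length_0_conv less_irrefl)
  then have hd: "ws ! 0 = v"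
  proof -
    have "hd ws = v" using gram_schmidt_hd[OF v(1), of vs] \<open>basis_completion v = v # vs\<close> by (simp add: ws_def)
    moreover have "ws \<noteq> []" using ws(3) n by auto
    ultimately show ?thesis by (simp add: hd_conv_nth)
  qed
  define nrm where "nrm j = (\<Sum>i<n. (cmod (ws ! j $ i))\<^sup>2)" for j
  have dim: "dim_vec (ws ! j) = n" if "j < n" for j
    using ws that by (metis carrier_vecD nth_mem subsetD)
  have inner: "(\<Sum>i<n. ws ! k $ i * cnj (ws ! j $ i)) = (if j = k then of_real (nrm k) else 0)"
    if "j < n" "k < n" for j k
  proof (cases "j = k")
    case True
    then show ?thesis by (simp only: nrm_def complex_norm_square of_real_sum simp_thms if_True)
  next
    case False
    then have "ws ! k \<bullet>c ws ! j = 0" using corthogonalD[OF ws(2)] ws(3) that by auto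
    then show ?thesis using False that
      by (simp add: scalar_prod_def dim lessThan_atLeast0)
  qed
  have pos: "nrm j > 0" if "j < n" for j
  proof -
    have "ws ! j \<bullet>c ws ! j \<noteq> 0" using corthogonalD[OF ws(2)] ws(3) that by auto
    then have "of_real (nrm j) \<noteq> (0 :: complex)"
      using inner[OF that that] that by (simp add: scalar_prod_def dim lessThan_atLeast0)
    moreover have "nrm j \<ge> 0" by (simp add: nrm_def sum_nonneg)
    ultimately show ?thesis by simp
  qed
  define U where "U = mat n n (\<lambda>(i, j). ws ! j $ i / of_real (sqrt (nrm j)))"
  have "mat_adjoint U * U = 1\<^sub>m n"
  proof (intro eq_matI)
    fix j k assume "j < dim_row (1\<^sub>m n :: complex mat)" "k < dim_col (1\<^sub>m n :: complex mat)"
    then have jk: "j < n" "k < n" by auto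
    have "(mat_adjoint U * U) $$ (j, k) =
        (\<Sum>i<n. ws ! k $ i * cnj (ws ! j $ i) / (of_real (sqrt (nrm j)) * of_real (sqrt (nrm k))))"
      using jk by (simp add: U_def scalar_prod_def lessThan_atLeast0 mult.commute)
    also have "\<dots> = (if j = k then of_real (nrm k) else 0) / (of_real (sqrt (nrm j)) * of_real (sqrt (nrm k)))"
      by (simp add: inner[OF jk] flip: sum_divide_distrib)
    also have "\<dots> = (1\<^sub>m n) $$ (j, k)"
      using jk pos[of k] by (auto simp: simp flip: of_real_mult)
    finally show "(mat_adjoint U * U) $$ (j, k) = 1\<^sub>m n $$ (j, k)" .
  qed (auto simp: U_def)
  then have "unitary_mat n U" by (simp add: unitary_mat_def U_def)
  moreover have "col U 0 = (1 / of_real (sqrt (nrm 0))) \<cdot>\<^sub>v v"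
    using n v by (intro eq_vecI) (auto simp: U_def hd)
  ultimately show thesis using that by blast
qed


lemma four_block_diag_mult:
  fixes A :: "complex mat"
  assumes "A \<in> carrier_mat k k" "A' \<in> carrier_mat k k" "B \<in> carrier_mat l l" "B' \<in> carrier_mat l l"
  shows "four_block_mat A (0\<^sub>m k l) (0\<^sub>m l k) B * four_block_mat A' (0\<^sub>m k l) (0\<^sub>m l k) B' =
    four_block_mat (A * A') (0\<^sub>m k l) (0\<^sub>m l k) (B * B')"
  using assms
  by (subst mult_four_block_mat[of _ k k _ l _ l _ _ k _ l]) simp_all

lemma mat_adjoint_four_block_diag:
  fixes A :: "complex mat"
  assumes "A \<in> carrier_mat k k" "B \<in> carrier_mat l l"
  shows "mat_adjoint (four_block_mat A (0\<^sub>m k l) (0\<^sub>m l k) B) =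
    four_block_mat (mat_adjoint A) (0\<^sub>m k l) (0\<^sub>m l k) (mat_adjoint B)"
  using assms by (intro eq_matI) auto

text \<open>
  The induction removes one eigenvalue at a time: in an orthonormal basis that starts with an
  eigenvector for \<open>e\<close>, the first column of \<open>H\<close> is \<open>(e, 0, \<dots>, 0)\<close>, and Hermitian symmetry clears the
  first row. The list of eigenvalues is an input, so that its order can be chosen by the user of the
  lemma.
\<close>
lemma hermitian_diagonalization:
  fixes H :: "complex mat"
  assumes "H \<in> carrier_mat n n" and "mat_adjoint H = H"
    and "char_poly H = (\<Prod>e\<leftarrow>es. [:- e, 1:])"
  shows "\<exists>U. unitary_mat n U \<and> mat_adjoint U * H * U = mat_diag n ((!) es)"
  using assms
proof (induction es arbitrary: n H)
  case Nil
  then have "n = 0" using degree_monic_char_poly[OF Nil(1)] by simp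
  then have "unitary_mat n (1\<^sub>m n) \<and> mat_adjoint (1\<^sub>m n) * H * 1\<^sub>m n = mat_diag n ((!) [])"
    using Nil(1) by (auto simp: unitary_mat_def mat_diag_def intro!: eq_matI)
  then show ?case by blast
next
  case (Cons e es)
  note H = Cons.prems(1)
  have "degree (char_poly H) = Suc (degree (\<Prod>e\<leftarrow>es. [:- e, 1:]))"
  proof -
    have "monic (\<Prod>e\<leftarrow>es. [:- e, 1:])" by (rule monic_prod_list) auto
    then show ?thesis unfolding Cons.prems(3) by (subst list.map, subst prod_list.Cons, subst degree_mult_eq) auto
  qed
  then obtain n1 where n: "n = Suc n1"
    using degree_monic_char_poly[OF H] by (cases n) auto
  have "eigenvalue H e"
    unfolding eigenvalue_root_char_poly[OF H] Cons.prems(3) by simp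
  then have "eigenvector H (find_eigenvector H e) e"
    by (rule find_eigenvector[OF H])
  then obtain v where v: "v \<in> carrier_vec n" "v \<noteq> 0\<^sub>v n" "H *\<^sub>v v = e \<cdot>\<^sub>v v"
    using H by (auto simp: eigenvector_def)
  obtain W c where W: "unitary_mat n W" and W0: "col W 0 = c \<cdot>\<^sub>v v"
    using exists_unitary_first_column[OF v(1,2)] by blast
  have WC: "W \<in> carrier_mat n n" and WW: "mat_adjoint W * W = 1\<^sub>m n"
    using W by (simp_all add: unitary_mat_def)
  note WA = mat_adjoint_carrier[OF WC]
  define H' where "H' = mat_adjoint W * H * W"
  have H'C: "H' \<in> carrier_mat n n"
    unfolding H'_def by (rule mult_carrier_mat[OF mult_carrier_mat[OF WA H] WC])
  have assoc: "H' = mat_adjoint W * (H * W)"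
    unfolding H'_def by (rule assoc_mult_mat[OF WA H WC])
  have herm: "mat_adjoint H' = H'"
  proof -
    have "mat_adjoint H' = mat_adjoint (H * W) * W"
      unfolding assoc using mat_adjoint_mult[OF WA mult_carrier_mat[OF H WC]] by simp
    also have "\<dots> = H'"
      unfolding mat_adjoint_mult[OF H WC] H'_def Cons.prems(2) ..
    finally show ?thesis .
  qed
  have col0: "H' $$ (i, 0) = (if i = 0 then e else 0)" if "i < n" for i
  proof -
    have "col (H * W) 0 = H *\<^sub>v (c \<cdot>\<^sub>v v)"
      using col_mult2[OF H WC, of 0] n W0 by simp
    also have "\<dots> = c \<cdot>\<^sub>v (e \<cdot>\<^sub>v v)"
      using mult_mat_vec[OF H v(1)] v(3) by simp
    also have "\<dots> = e \<cdot>\<^sub>v col W 0"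
      unfolding W0 by (simp add: smult_smult_assoc mult.commute)
    finally have HW: "col (H * W) 0 = e \<cdot>\<^sub>v col W 0" .
    have "col H' 0 = mat_adjoint W *\<^sub>v (e \<cdot>\<^sub>v col W 0)"
      unfolding assoc HW[symmetric] using n by (intro col_mult2[OF WA mult_carrier_mat[OF H WC]]) simp
    also have "\<dots> = e \<cdot>\<^sub>v (mat_adjoint W *\<^sub>v col W 0)"
      using WC n by (intro mult_mat_vec[OF WA] col_carrier_vec) auto
    also have "mat_adjoint W *\<^sub>v col W 0 = col (1\<^sub>m n) 0"
      using col_mult2[OF WA WC, of 0] n WW by simp
    finally have "col H' 0 $ i = (e \<cdot>\<^sub>v col (1\<^sub>m n) 0) $ i" by simp
    then show ?thesis using that n H'C by auto
  qed
  have row0: "H' $$ (0, j) = 0" if "0 < j" "j < n" for j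
  proof -
    have "H' $$ (0, j) = mat_adjoint H' $$ (0, j)" by (simp add: herm)
    also have "\<dots> = cnj (H' $$ (j, 0))" using that n H'C by simp
    finally show ?thesis using col0[of j] that by simp
  qed
  define H3 where "H3 = mat n1 n1 (\<lambda>(i, j). H' $$ (Suc i, Suc j))"
  have H3C: "H3 \<in> carrier_mat n1 n1" by (simp add: H3_def)
  define E where "E = mat 1 1 (\<lambda>_. e)"
  have EC: "E \<in> carrier_mat 1 1" by (simp add: E_def)
  have block: "H' = four_block_mat E (0\<^sub>m 1 n1) (0\<^sub>m n1 1) H3"
  proof (intro eq_matI)
    fix i j
    assume "i < dim_row (four_block_mat E (0\<^sub>m 1 n1) (0\<^sub>m n1 1) H3)"
      "j < dim_col (four_block_mat E (0\<^sub>m 1 n1) (0\<^sub>m n1 1) H3)"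
    then have ij: "i < n" "j < n" using n by (auto simp: E_def H3_def)
    show "H' $$ (i, j) = four_block_mat E (0\<^sub>m 1 n1) (0\<^sub>m n1 1) H3 $$ (i, j)"
      using ij n col0[of i] row0[of j] by (cases i; cases j) (auto simp: E_def H3_def)
  qed (use H'C n in \<open>auto simp: E_def H3_def\<close>)
  have herm3: "mat_adjoint H3 = H3"
  proof (intro eq_matI)
    fix i j assume "i < dim_row H3" "j < dim_col H3"
    then have ij: "i < n1" "j < n1" by (simp_all add: H3_def)
    have "H' $$ (Suc i, Suc j) = mat_adjoint H' $$ (Suc i, Suc j)" by (simp add: herm)
    also have "\<dots> = cnj (H' $$ (Suc j, Suc i))" using ij n H'C by simp
    finally show "mat_adjoint H3 $$ (i, j) = H3 $$ (i, j)"
      using ij by (simp add: H3_def)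
  qed (simp_all add: H3_def)
  have "similar_mat H' H"
    unfolding similar_mat_def
    by (intro exI, rule similar_mat_witI[OF WW unitary_mat_right[OF W] H'_def H'C H WA WC])
  then have "char_poly H' = char_poly H" by (rule char_poly_similar)
  then have "char_poly E * char_poly H3 = [:- e, 1:] * (\<Prod>e\<leftarrow>es. [:- e, 1:])"
    using Cons.prems(3) char_poly_four_block_zeros_col[OF EC _ H3C, of "0\<^sub>m 1 n1"]
    unfolding block by simp
  moreover have "char_poly E = [:- e, 1:]"
    by (simp add: E_def char_poly_defs det_def sign_def)
  ultimately have "char_poly H3 = (\<Prod>e\<leftarrow>es. [:- e, 1:])"
    by (metis mult_cancel_left pCons_eq_0_iff zero_neq_one)
  from Cons.IH[OF H3C herm3 this] obtain U3 where U3: "unitary_mat n1 U3"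
    and diag3: "mat_adjoint U3 * H3 * U3 = mat_diag n1 ((!) es)" by blast
  have U3C: "U3 \<in> carrier_mat n1 n1" and UU3: "mat_adjoint U3 * U3 = 1\<^sub>m n1"
    using U3 by (simp_all add: unitary_mat_def)
  note U3A = mat_adjoint_carrier[OF U3C]
  define V where "V = four_block_mat (1\<^sub>m 1) (0\<^sub>m 1 n1) (0\<^sub>m n1 1) U3"
  have VC: "V \<in> carrier_mat n n" using four_block_carrier_mat[OF one_carrier_mat U3C, of 1] n by (simp add: V_def)
  note VA = mat_adjoint_carrier[OF VC]
  have one: "mat_adjoint (1\<^sub>m 1) = (1\<^sub>m 1 :: complex mat)" by (intro eq_matI) auto
  have adjV: "mat_adjoint V = four_block_mat (1\<^sub>m 1) (0\<^sub>m 1 n1) (0\<^sub>m n1 1) (mat_adjoint U3)"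
    unfolding V_def using mat_adjoint_four_block_diag[OF one_carrier_mat U3C] one by simp
  have "mat_adjoint V * V = four_block_mat (1\<^sub>m 1) (0\<^sub>m 1 n1) (0\<^sub>m n1 1) (1\<^sub>m n1)"
    unfolding adjV unfolding V_def
    using four_block_diag_mult[OF one_carrier_mat one_carrier_mat U3A U3C] UU3 by simp
  also have "\<dots> = 1\<^sub>m n" using n by (intro eq_matI) auto
  finally have V: "unitary_mat n V" using VC by (simp add: unitary_mat_def)
  have "mat_adjoint V * H' * V = four_block_mat E (0\<^sub>m 1 n1) (0\<^sub>m n1 1) (mat_adjoint U3 * H3 * U3)"
    unfolding adjV block unfolding V_def
    using four_block_diag_mult[OF one_carrier_mat EC U3A H3C] EC
      four_block_diag_mult[OF EC one_carrier_mat mult_carrier_mat[OF U3A H3C] U3C] by simp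
  also have "\<dots> = mat_diag n ((!) (e # es))"
    unfolding diag3 using n by (intro eq_matI) (auto simp: E_def mat_diag_def nth_Cons' Suc_diff_Suc)
  finally have "mat_adjoint V * H' * V = mat_diag n ((!) (e # es))" .
  moreover have "mat_adjoint (W * V) * H * (W * V) = mat_adjoint V * H' * V"
  proof -
    have sq: "A * B \<in> carrier_mat n n"
      if "A \<in> carrier_mat n n" "B \<in> carrier_mat n n" for A B :: "complex mat"
      using that by simp
    have sq_assoc: "A * B * C = A * (B * C)"
      if "A \<in> carrier_mat n n" "B \<in> carrier_mat n n" "C \<in> carrier_mat n n" for A B C :: "complex mat"
      using that by (rule assoc_mult_mat)
    show ?thesis
      unfolding mat_adjoint_mult[OF WC VC] H'_def by (simp only: sq sq_assoc WA VA H WC VC)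
  qed
  ultimately show ?case using unitary_mat_mult[OF W V] by auto
qed

section \<open>The singular value decomposition\<close>

definition vec_norm2 :: "complex vec \<Rightarrow> real" where
  "vec_norm2 v = L2_set (\<lambda>i. cmod (v $ i)) {..<dim_vec v}"

lemma vec_norm2_nonneg [simp]: "vec_norm2 v \<ge> 0"
  by (simp add: vec_norm2_def)

lemma vec_norm2_squared: "(vec_norm2 v)\<^sup>2 = (\<Sum>i<dim_vec v. (cmod (v $ i))\<^sup>2)"
  by (simp add: vec_norm2_def L2_set_def sum_nonneg)

lemma vec_norm2_inner: "complex_of_real ((vec_norm2 v)\<^sup>2) = v \<bullet>c v"
  unfolding vec_norm2_squared of_real_sum complex_norm_square
  by (simp add: scalar_prod_def lessThan_atLeast0)

lemma inner_mat_adjoint: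
  fixes M :: "complex mat"
  assumes "M \<in> carrier_mat m n" and "x \<in> carrier_vec n" and "y \<in> carrier_vec m"
  shows "(M *\<^sub>v x) \<bullet>c y = x \<bullet>c (mat_adjoint M *\<^sub>v y)"
proof -
  have "(M *\<^sub>v x) \<bullet>c y = (\<Sum>i<m. \<Sum>j<n. M $$ (i, j) * x $ j * cnj (y $ i))"
    using assms by (simp add: scalar_prod_def lessThan_atLeast0 sum_distrib_right)
  also have "\<dots> = (\<Sum>j<n. \<Sum>i<m. M $$ (i, j) * x $ j * cnj (y $ i))"
    by (rule sum.swap)
  also have "\<dots> = x \<bullet>c (mat_adjoint M *\<^sub>v y)"
    using assms by (simp add: scalar_prod_def lessThan_atLeast0 sum_distrib_left mult.assoc mult.left_commute)
  finally show ?thesis .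
qed

lemma vec_norm2_mult_mat:
  assumes "M \<in> carrier_mat m n" and "x \<in> carrier_vec n"
  shows "complex_of_real ((vec_norm2 (M *\<^sub>v x))\<^sup>2) = x \<bullet>c ((mat_adjoint M * M) *\<^sub>v x)"
  unfolding vec_norm2_inner
  using assms mult_mat_vec_carrier[OF assms] mat_adjoint_carrier[OF assms(1)]
  by (simp only: inner_mat_adjoint[OF assms] assoc_mult_mat_vec[of _ n m])

lemma vec_norm2_unitary:
  assumes "unitary_mat n U" and "c \<in> carrier_vec n"
  shows "vec_norm2 (U *\<^sub>v c) = vec_norm2 c"
proof -
  have "complex_of_real ((vec_norm2 (U *\<^sub>v c))\<^sup>2) = of_real ((vec_norm2 c)\<^sup>2)"
    unfolding vec_norm2_inner[of c]
    using vec_norm2_mult_mat[of U n n c] assms by (simp add: unitary_mat_def)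
  then have "(vec_norm2 (U *\<^sub>v c))\<^sup>2 = (vec_norm2 c)\<^sup>2" by (simp only: of_real_eq_iff)
  then show ?thesis by simp
qed

lemma singular_values_eq_sorted:
  assumes "char_poly (mat_adjoint M * M) = (\<Prod>e\<leftarrow>es. [:- e, 1:])"
  shows "singular_values M = rev (sort (map (\<lambda>x. sqrt (Re x)) es))"
proof -
  have "proots (\<Prod>e\<leftarrow>es. [:- e, 1:]) = mset es" for es :: "complex list"
  proof (induction es)
    case (Cons e es)
    have "(\<Prod>e\<leftarrow>es. [:- e, 1:]) \<noteq> 0" by (auto simp: prod_list_zero_iff)
    then have "proots ([:- e, 1:] * (\<Prod>e\<leftarrow>es. [:- e, 1:])) = {#e#} + mset es"
      using Cons by (subst proots_mult) auto
    then show ?case by simp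
  qed simp
  then have "image_mset (\<lambda>x. sqrt (Re x)) (proots (char_poly (mat_adjoint M * M))) =
      mset (map (\<lambda>x. sqrt (Re x)) es)"
    using assms by simp
  then show ?thesis by (simp only: singular_values_def sorted_list_of_multiset_mset)
qed

text \<open>
  The right singular basis \<open>U\<close> is all that is needed: it turns the norm of \<open>M\<close> into a weighted sum of
  squares of coordinates, with the weights in the order of \<open>singular_values\<close>. It diagonalizes
  \<open>M\<^sup>* M\<close>, for the list of eigenvalues sorted in the same way as in the definition.
\<close>
lemma singular_value_decomposition:
  assumes M: "M \<in> carrier_mat m n"
  shows "\<exists>U. unitary_mat n U \<and> (\<forall>c \<in> carrier_vec n.
      (vec_norm2 (M *\<^sub>v (U *\<^sub>v c)))\<^sup>2 = (\<Sum>l<n. (singular_values M ! l)\<^sup>2 * (cmod (c $ l))\<^sup>2))"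
    and length_singular_values: "length (singular_values M) = n"
    and singular_values_nonneg: "\<And>l. l < n \<Longrightarrow> singular_values M ! l \<ge> 0"
proof -
  define H where "H = mat_adjoint M * M"
  have H: "H \<in> carrier_mat n n"
    unfolding H_def by (rule mult_carrier_mat[OF mat_adjoint_carrier[OF M] M])
  have herm: "mat_adjoint H = H"
    unfolding H_def using mat_adjoint_mult[OF mat_adjoint_carrier[OF M] M] by simp
  obtain ds where ds: "char_poly H = (\<Prod>e\<leftarrow>ds. [:- e, 1:])" and len: "length ds = n"
    using char_poly_factorized[OF H] by blast
  define es where "es = rev (sort_key (\<lambda>x. sqrt (Re x)) ds)"
  have mset: "mset es = mset ds" by (simp add: es_def)
  have es: "char_poly H = (\<Prod>e\<leftarrow>es. [:- e, 1:])"
    unfolding ds by (simp only: prod_mset_prod_list[symmetric] mset_map mset)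
  have len_es: "length es = n" by (simp add: es_def len)
  have "sorted (rev (map (\<lambda>x. sqrt (Re x)) es))"
    by (simp add: es_def rev_map)
  then have "rev (sort (map (\<lambda>x. sqrt (Re x)) es)) = map (\<lambda>x. sqrt (Re x)) es"
    by (metis mset_rev rev_rev_ident sorted_list_of_multiset_mset sorted_sort_id)
  then have sv: "singular_values M = map (\<lambda>x. sqrt (Re x)) es"
    using singular_values_eq_sorted[OF es[unfolded H_def]] by simp
  obtain U where U: "unitary_mat n U" and diag: "mat_adjoint U * H * U = mat_diag n ((!) es)"
    using hermitian_diagonalization[OF H herm es] by blast
  have UC: "U \<in> carrier_mat n n" using U by (simp add: unitary_mat_def)
  note UA = mat_adjoint_carrier[OF UC]
  note MA = mat_adjoint_carrier[OF M]
  have "mat_adjoint (M * U) * (M * U) = mat_diag n ((!) es)"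
    unfolding mat_adjoint_mult[OF M UC] diag[symmetric] H_def
    using assoc_mult_mat[OF mult_carrier_mat[OF UA MA] M UC] assoc_mult_mat[OF UA MA M] by simp
  then have norm: "complex_of_real ((vec_norm2 (M *\<^sub>v (U *\<^sub>v c)))\<^sup>2) =
      (\<Sum>l<n. cnj (es ! l) * of_real ((cmod (c $ l))\<^sup>2))" if c: "c \<in> carrier_vec n" for c
  proof -
    have "complex_of_real ((vec_norm2 (M *\<^sub>v (U *\<^sub>v c)))\<^sup>2) = c \<bullet>c (mat_diag n ((!) es) *\<^sub>v c)"
      using vec_norm2_mult_mat[OF mult_carrier_mat[OF M UC] c] assoc_mult_mat_vec[OF M UC c]
        \<open>mat_adjoint (M * U) * (M * U) = _\<close> by simp
    also have "\<dots> = (\<Sum>l<n. c $ l * cnj ((mat_diag n ((!) es) *\<^sub>v c) $ l))"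
      using c by (simp add: scalar_prod_def mat_diag_def lessThan_atLeast0)
    also have "\<dots> = (\<Sum>l<n. cnj (es ! l) * of_real ((cmod (c $ l))\<^sup>2))"
    proof (rule sum.cong[OF refl])
      fix l assume "l \<in> {..<n}"
      then have l: "l < n" by simp
      have "(mat_diag n ((!) es) *\<^sub>v c) $ l = (\<Sum>j<n. (if l = j then es ! j else 0) * c $ j)"
        using l c by (simp add: mat_diag_def scalar_prod_def lessThan_atLeast0)
      also have "\<dots> = (\<Sum>j<n. if j = l then es ! l * c $ l else 0)"
        by (intro sum.cong) auto
      finally have "(mat_diag n ((!) es) *\<^sub>v c) $ l = (\<Sum>j<n. if j = l then es ! l * c $ l else 0)" .
      then show "c $ l * cnj ((mat_diag n ((!) es) *\<^sub>v c) $ l) = cnj (es ! l) * of_real ((cmod (c $ l))\<^sup>2)"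
        using l by (simp only: complex_norm_square) (simp add: mult_ac)
    qed
    finally show ?thesis .
  qed
  \<comment> \<open>Evaluating the norm at a unit vector shows that the eigenvalue is a squared norm.\<close>
  have ev: "\<exists>x\<ge>0. es ! l = complex_of_real x" if l: "l < n" for l
  proof -
    have "(\<Sum>k<n. cnj (es ! k) * of_real ((cmod (unit_vec n l $ k))\<^sup>2)) = (\<Sum>k<n. if k = l then cnj (es ! l) else 0)"
      using l by (intro sum.cong) auto
    then have "complex_of_real ((vec_norm2 (M *\<^sub>v (U *\<^sub>v unit_vec n l)))\<^sup>2) = cnj (es ! l)"
      using norm[of "unit_vec n l"] l by simp
    then have "es ! l = complex_of_real ((vec_norm2 (M *\<^sub>v (U *\<^sub>v unit_vec n l)))\<^sup>2)"
      by (metis complex_cnj_cnj complex_cnj_complex_of_real)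
    then show ?thesis by (intro exI[of _ "(vec_norm2 (M *\<^sub>v (U *\<^sub>v unit_vec n l)))\<^sup>2"]) simp
  qed
  have sv_sq: "(singular_values M ! l)\<^sup>2 = Re (es ! l)" "es ! l = of_real (Re (es ! l))"
    "singular_values M ! l \<ge> 0" if "l < n" for l
    using ev[OF that] that by (auto simp: sv len_es)
  show "length (singular_values M) = n" by (simp add: sv len_es)
  show "singular_values M ! l \<ge> 0" if "l < n" for l using sv_sq(3)[OF that] .
  show "\<exists>U. unitary_mat n U \<and> (\<forall>c \<in> carrier_vec n.
      (vec_norm2 (M *\<^sub>v (U *\<^sub>v c)))\<^sup>2 = (\<Sum>l<n. (singular_values M ! l)\<^sup>2 * (cmod (c $ l))\<^sup>2))"
  proof (intro exI[of _ U] conjI ballI U)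
    fix c :: "complex vec" assume c: "c \<in> carrier_vec n"
    have "(\<Sum>l<n. cnj (es ! l) * of_real ((cmod (c $ l))\<^sup>2)) =
      (\<Sum>l<n. complex_of_real ((singular_values M ! l)\<^sup>2 * (cmod (c $ l))\<^sup>2))"
    proof (intro sum.cong refl)
      fix l assume "l \<in> {..<n}"
      then have "cnj (es ! l) = of_real ((singular_values M ! l)\<^sup>2)"
        using sv_sq[of l] by (metis complex_cnj_complex_of_real lessThan_iff)
      then show "cnj (es ! l) * of_real ((cmod (c $ l))\<^sup>2) =
        complex_of_real ((singular_values M ! l)\<^sup>2 * (cmod (c $ l))\<^sup>2)" by simp
    qed
    then have "complex_of_real ((vec_norm2 (M *\<^sub>v (U *\<^sub>v c)))\<^sup>2) =
        of_real (\<Sum>l<n. (singular_values M ! l)\<^sup>2 * (cmod (c $ l))\<^sup>2)"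
      using norm[OF c] by simp
    then show "(vec_norm2 (M *\<^sub>v (U *\<^sub>v c)))\<^sup>2 = (\<Sum>l<n. (singular_values M ! l)\<^sup>2 * (cmod (c $ l))\<^sup>2)"
      by (simp only: of_real_eq_iff)
  qed
qed

lemma singular_values_decreasing:
  assumes "M \<in> carrier_mat m n" and "j \<le> l" and "l < n"
  shows "singular_values M ! l \<le> singular_values M ! j"
proof -
  have "sorted (rev (singular_values M))"
    by (simp add: singular_values_def)
  then show ?thesis
    using assms(2,3) length_singular_values[OF assms(1)] by (simp add: sorted_rev_nth_mono)
qed

section \<open>Comparing singular values through a linear map\<close>

text \<open>
  Completed by a zero row, the \<open>p\<close> equations form a singular square system.
\<close>
lemma exists_kernel_vec_underdetermined:
  fixes K :: "nat \<Rightarrow> nat \<Rightarrow> complex"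
  obtains d where "d \<in> carrier_vec (Suc p)" "d \<noteq> 0\<^sub>v (Suc p)"
    "\<And>a. a < p \<Longrightarrow> (\<Sum>b\<le>p. K a b * d $ b) = 0"
proof -
  define S where "S = mat (Suc p) (Suc p) (\<lambda>(a, b). if a = p then 0 else K a b)"
  have S: "S \<in> carrier_mat (Suc p) (Suc p)" by (simp add: S_def)
  have "S = mat\<^sub>r (Suc p) (Suc p) (\<lambda>i. if i = p then 0\<^sub>v (Suc p) else vec (Suc p) (K i))"
    by (intro eq_matI) (auto simp: S_def)
  then have "det S = 0" using det_row_0[of p "Suc p" "\<lambda>i. vec (Suc p) (K i)"] by simp
  then obtain d where d: "d \<in> carrier_vec (Suc p)" "d \<noteq> 0\<^sub>v (Suc p)" "S *\<^sub>v d = 0\<^sub>v (Suc p)"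
    using det_0_iff_vec_prod_zero_field[OF S] by blast
  have "(\<Sum>b\<le>p. K a b * d $ b) = 0" if "a < p" for a
  proof -
    have "(\<Sum>b\<le>p. K a b * d $ b) = (S *\<^sub>v d) $ a"
      using that d(1) by (simp add: S_def scalar_prod_def lessThan_Suc_atMost[symmetric] lessThan_atLeast0 del: sum.op_ivl_Suc)
    then show ?thesis using d(3) that by simp
  qed
  then show thesis using that d by blast
qed

text \<open>
  The Courant-Fischer argument: in the span of the first \<open>p + 1\<close> right singular vectors of \<open>A\<close> the map
  \<open>A\<close> stretches by at least the singular value with index \<open>p\<close>. The \<open>p\<close> conditions that \<open>T v\<close> be
  orthogonal to the first \<open>p\<close> right singular vectors of \<open>B\<close> leave a nonzero \<open>v\<close> in this span, and on
  such \<open>T v\<close> the map \<open>B\<close> stretches by at most its singular value with index \<open>p\<close>. Both sides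
  are compared with the norm of \<open>v\<close>, so the argument applies also where \<open>T\<close> is far from isometric.
\<close>
lemma singular_value_transfer:
  fixes A B T :: "complex mat"
  assumes A: "A \<in> carrier_mat m n" and B: "B \<in> carrier_mat r s" and T: "T \<in> carrier_mat s n"
    and p: "p < n" "p < s" and nonneg: "\<alpha> \<ge> 0"
    and bound: "\<And>v. v \<in> carrier_vec n \<Longrightarrow>
      \<alpha> * vec_norm2 (A *\<^sub>v v) \<le> vec_norm2 (B *\<^sub>v (T *\<^sub>v v)) + \<beta> * vec_norm2 v"
    and T_bound: "\<And>v. v \<in> carrier_vec n \<Longrightarrow> vec_norm2 (T *\<^sub>v v) \<le> \<gamma> * vec_norm2 v"
  shows "\<alpha> * singular_values A ! p \<le> \<gamma> * singular_values B ! p + \<beta>"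
proof -
  obtain U where U: "unitary_mat n U"
    and normA: "\<forall>c \<in> carrier_vec n.
      (vec_norm2 (A *\<^sub>v (U *\<^sub>v c)))\<^sup>2 = (\<Sum>l<n. (singular_values A ! l)\<^sup>2 * (cmod (c $ l))\<^sup>2)"
    using singular_value_decomposition[OF A] by blast
  obtain W where W: "unitary_mat s W"
    and normB: "\<forall>c \<in> carrier_vec s.
      (vec_norm2 (B *\<^sub>v (W *\<^sub>v c)))\<^sup>2 = (\<Sum>l<s. (singular_values B ! l)\<^sup>2 * (cmod (c $ l))\<^sup>2)"
    using singular_value_decomposition[OF B] by blast
  note nonnegA = singular_values_nonneg[OF A] and nonnegB = singular_values_nonneg[OF B]
  have UC: "U \<in> carrier_mat n n" and WC: "W \<in> carrier_mat s s"
    using U W by (simp_all add: unitary_mat_def)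
  note WA = mat_adjoint_carrier[OF WC]
  define N where "N = mat_adjoint W * (T * U)"
  have N: "N \<in> carrier_mat s n"
    unfolding N_def by (rule mult_carrier_mat[OF WA mult_carrier_mat[OF T UC]])
  obtain d where d: "d \<in> carrier_vec (Suc p)" "d \<noteq> 0\<^sub>v (Suc p)"
    "\<And>a. a < p \<Longrightarrow> (\<Sum>b\<le>p. N $$ (a, b) * d $ b) = 0"
    using exists_kernel_vec_underdetermined[of p "\<lambda>a b. N $$ (a, b)"] by blast
  define c where "c = vec n (\<lambda>b. if b \<le> p then d $ b else 0)"
  have c: "c \<in> carrier_vec n" by (simp add: c_def)
  define v where "v = U *\<^sub>v c"
  have v: "v \<in> carrier_vec n" unfolding v_def by (rule mult_mat_vec_carrier[OF UC c])
  define y where "y = N *\<^sub>v c"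
  have y: "y \<in> carrier_vec s" unfolding y_def by (rule mult_mat_vec_carrier[OF N c])
  have norm_v: "vec_norm2 v = vec_norm2 c" unfolding v_def by (rule vec_norm2_unitary[OF U c])
  have v_pos: "vec_norm2 v > 0"
  proof -
    have "\<exists>b<Suc p. d $ b \<noteq> 0"
    proof (rule ccontr)
      assume "\<not> (\<exists>b<Suc p. d $ b \<noteq> 0)"
      then have "d = 0\<^sub>v (Suc p)" using d(1) by (intro eq_vecI) simp_all
      with d(2) show False by contradiction
    qed
    then obtain b where b: "b < Suc p" "d $ b \<noteq> 0" by blast
    have "0 < (cmod (c $ b))\<^sup>2" using b p by (simp add: c_def)
    also have "\<dots> \<le> (\<Sum>i<n. (cmod (c $ i))\<^sup>2)"
      using b p by (intro member_le_sum) auto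
    also have "\<dots> = (vec_norm2 c)\<^sup>2" by (simp add: vec_norm2_squared c_def)
    finally have "vec_norm2 c \<noteq> 0" by auto
    then show ?thesis using norm_v vec_norm2_nonneg[of c] by linarith
  qed
  have Wy: "T *\<^sub>v v = W *\<^sub>v y"
  proof -
    have "W *\<^sub>v y = (W * mat_adjoint W) *\<^sub>v ((T * U) *\<^sub>v c)"
      unfolding y_def N_def
      using assoc_mult_mat_vec[OF WA mult_carrier_mat[OF T UC] c]
        assoc_mult_mat_vec[OF WC WA mult_mat_vec_carrier[OF mult_carrier_mat[OF T UC] c]] by simp
    also have "\<dots> = T *\<^sub>v v"
      unfolding v_def unitary_mat_right[OF W]
      using assoc_mult_mat_vec[OF T UC c] mult_mat_vec_carrier[OF mult_carrier_mat[OF T UC] c] by simp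
    finally show ?thesis by simp
  qed
  have y0: "y $ a = 0" if "a < p" for a
  proof -
    have "y $ a = (\<Sum>b<n. N $$ (a, b) * c $ b)"
      using that p N c by (simp add: y_def scalar_prod_def lessThan_atLeast0)
    also have "\<dots> = (\<Sum>b\<le>p. N $$ (a, b) * d $ b)"
      using p by (intro sum.mono_neutral_cong_right) (auto simp: c_def)
    finally show ?thesis using d(3)[OF that] by simp
  qed
  have lower: "singular_values A ! p * vec_norm2 v \<le> vec_norm2 (A *\<^sub>v v)"
  proof (rule power2_le_imp_le)
    have "(singular_values A ! p * vec_norm2 v)\<^sup>2 = (\<Sum>l<n. (singular_values A ! p)\<^sup>2 * (cmod (c $ l))\<^sup>2)"
      by (simp add: norm_v power_mult_distrib vec_norm2_squared sum_distrib_left c_def)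
    also have "\<dots> \<le> (\<Sum>l<n. (singular_values A ! l)\<^sup>2 * (cmod (c $ l))\<^sup>2)"
    proof (rule sum_mono)
      fix l assume "l \<in> {..<n}"
      then show "(singular_values A ! p)\<^sup>2 * (cmod (c $ l))\<^sup>2 \<le> (singular_values A ! l)\<^sup>2 * (cmod (c $ l))\<^sup>2"
        using singular_values_decreasing[OF A _ p(1), of l] nonnegA[OF p(1)]
        by (cases "l \<le> p") (auto simp: c_def intro!: mult_right_mono power_mono)
    qed
    also have "\<dots> = (vec_norm2 (A *\<^sub>v v))\<^sup>2" unfolding v_def by (simp add: bspec[OF normA c])
    finally show "(singular_values A ! p * vec_norm2 v)\<^sup>2 \<le> (vec_norm2 (A *\<^sub>v v))\<^sup>2" .
  qed simp
  have upper: "vec_norm2 (B *\<^sub>v (T *\<^sub>v v)) \<le> singular_values B ! p * vec_norm2 (T *\<^sub>v v)"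
  proof (rule power2_le_imp_le)
    have "(vec_norm2 (B *\<^sub>v (T *\<^sub>v v)))\<^sup>2 = (\<Sum>l<s. (singular_values B ! l)\<^sup>2 * (cmod (y $ l))\<^sup>2)"
      unfolding Wy by (rule bspec[OF normB y])
    also have "\<dots> \<le> (\<Sum>l<s. (singular_values B ! p)\<^sup>2 * (cmod (y $ l))\<^sup>2)"
    proof (rule sum_mono)
      fix l assume "l \<in> {..<s}"
      then show "(singular_values B ! l)\<^sup>2 * (cmod (y $ l))\<^sup>2 \<le> (singular_values B ! p)\<^sup>2 * (cmod (y $ l))\<^sup>2"
        using singular_values_decreasing[OF B, of p l] nonnegB[of l] y0[of l]
        by (cases "l < p") (auto intro!: mult_right_mono power_mono)
    qed
    also have "\<dots> = (singular_values B ! p * vec_norm2 (T *\<^sub>v v))\<^sup>2"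
      unfolding Wy vec_norm2_unitary[OF W y] using y
      by (simp add: power_mult_distrib vec_norm2_squared sum_distrib_left)
    finally show "(vec_norm2 (B *\<^sub>v (T *\<^sub>v v)))\<^sup>2 \<le> (singular_values B ! p * vec_norm2 (T *\<^sub>v v))\<^sup>2" .
  qed (simp add: nonnegB[OF p(2)])
  have "\<alpha> * (singular_values A ! p * vec_norm2 v) \<le> \<alpha> * vec_norm2 (A *\<^sub>v v)"
    using lower nonneg by (rule mult_left_mono)
  also have "\<dots> \<le> vec_norm2 (B *\<^sub>v (T *\<^sub>v v)) + \<beta> * vec_norm2 v" by (rule bound[OF v])
  also have "\<dots> \<le> singular_values B ! p * (\<gamma> * vec_norm2 v) + \<beta> * vec_norm2 v"
    using upper mult_left_mono[OF T_bound[OF v] nonnegB[OF p(2)]] by linarith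
  finally have "(\<alpha> * singular_values A ! p) * vec_norm2 v \<le> (\<gamma> * singular_values B ! p + \<beta>) * vec_norm2 v"
    by (simp add: algebra_simps)
  then show ?thesis using v_pos by simp
qed

section \<open>The cut norm controls the operator norm\<close>

text \<open>
  The left-hand side is convex in the weights, so its maximum over the cube \<open>[0, 1]\<^sup>D\<close> is attained at
  a vertex, that is, at an indicator function. The offset \<open>h\<close> carries the terms whose weight has
  already been rounded in the induction.
\<close>
lemma convex_weights_bound:
  fixes E :: "'a \<Rightarrow> 'b \<Rightarrow> complex"
  assumes "finite D"
    and "\<And>X. X \<subseteq> D \<Longrightarrow> (\<Sum>y\<in>F. cmod (h y + (\<Sum>x\<in>X. E x y))) \<le> K"
    and "\<And>x. x \<in> D \<Longrightarrow> 0 \<le> w x \<and> w x \<le> (1 :: real)"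
  shows "(\<Sum>y\<in>F. cmod (h y + (\<Sum>x\<in>D. of_real (w x) * E x y))) \<le> K"
  using assms
proof (induction D arbitrary: h rule: finite_induct)
  case empty
  then show ?case using empty(1)[of "{}"] by simp
next
  case (insert z D)
  have "(\<Sum>y\<in>F. cmod (h y + (\<Sum>x\<in>X. E x y))) \<le> K" if "X \<subseteq> D" for X
    using insert.prems(1)[of X] that by auto
  then have 0: "(\<Sum>y\<in>F. cmod (h y + (\<Sum>x\<in>D. of_real (w x) * E x y))) \<le> K"
    using insert.IH[of h] insert.prems(2) by blast
  have "(\<Sum>y\<in>F. cmod ((h y + E z y) + (\<Sum>x\<in>X. E x y))) \<le> K" if "X \<subseteq> D" for X
  proof -
    have "z \<notin> X" "finite X" using that insert.hyps finite_subset by auto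
    then show ?thesis using insert.prems(1)[of "insert z X"] that by (auto simp: add.assoc)
  qed
  then have 1: "(\<Sum>y\<in>F. cmod ((h y + E z y) + (\<Sum>x\<in>D. of_real (w x) * E x y))) \<le> K"
    using insert.IH[of "\<lambda>y. h y + E z y"] insert.prems(2) by blast
  have w: "0 \<le> w z" "w z \<le> 1" using insert.prems(2) by auto
  let ?S = "\<lambda>y. \<Sum>x\<in>D. of_real (w x) * E x y"
  have "(\<Sum>y\<in>F. cmod (h y + (\<Sum>x\<in>insert z D. of_real (w x) * E x y)))
      = (\<Sum>y\<in>F. cmod (of_real (1 - w z) * (h y + ?S y) + of_real (w z) * ((h y + E z y) + ?S y)))"
    using insert.hyps by (simp add: algebra_simps)
  also have "\<dots> \<le> (\<Sum>y\<in>F. (1 - w z) * cmod (h y + ?S y) + w z * cmod ((h y + E z y) + ?S y))"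
  proof (rule sum_mono)
    fix y
    show "cmod (of_real (1 - w z) * (h y + ?S y) + of_real (w z) * ((h y + E z y) + ?S y))
      \<le> (1 - w z) * cmod (h y + ?S y) + w z * cmod ((h y + E z y) + ?S y)"
      using w by (intro order_trans[OF norm_triangle_ineq]) (simp add: norm_mult del: of_real_diff)
  qed
  also have "\<dots> = (1 - w z) * (\<Sum>y\<in>F. cmod (h y + ?S y)) + w z * (\<Sum>y\<in>F. cmod ((h y + E z y) + ?S y))"
    by (simp add: sum.distrib sum_distrib_left)
  also have "\<dots> \<le> (1 - w z) * K + w z * K"
    using w 0 1 by (intro add_mono mult_left_mono) auto
  finally show ?case by (simp add: algebra_simps)
qed

text \<open>
  With \<open>C = c \<bar>D\<bar> \<bar>F\<bar>\<close> this says that the cut norm is at most \<open>c\<close>. Arbitrary index sets allow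
  matrices to be reindexed and cut into blocks freely.
\<close>
definition rectangle_sums_bounded :: "('a \<Rightarrow> 'b \<Rightarrow> complex) \<Rightarrow> 'a set \<Rightarrow> 'b set \<Rightarrow> real \<Rightarrow> bool" where
  "rectangle_sums_bounded E D F C \<longleftrightarrow>
     (\<forall>X \<subseteq> D. \<forall>Y \<subseteq> F. cmod (\<Sum>x\<in>X. \<Sum>y\<in>Y. E x y) \<le> C)"

lemma rectangle_sums_boundedD:
  assumes "rectangle_sums_bounded E D F C" and "X \<subseteq> D" and "Y \<subseteq> F"
  shows "cmod (\<Sum>x\<in>X. \<Sum>y\<in>Y. E x y) \<le> C"
  using assms by (simp add: rectangle_sums_bounded_def)

lemma rectangle_sums_bounded_cong:
  assumes "\<And>x y. x \<in> D \<Longrightarrow> y \<in> F \<Longrightarrow> E x y = E' x y"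
  shows "rectangle_sums_bounded E D F C \<longleftrightarrow> rectangle_sums_bounded E' D F C"
proof -
  have "(\<Sum>x\<in>X. \<Sum>y\<in>Y. E x y) = (\<Sum>x\<in>X. \<Sum>y\<in>Y. E' x y)" if "X \<subseteq> D" "Y \<subseteq> F" for X Y
    using that assms by (intro sum.cong) auto
  then show ?thesis by (simp add: rectangle_sums_bounded_def)
qed

lemma sum_abs_real_le:
  fixes g :: "'b \<Rightarrow> real"
  assumes "finite F" and "\<And>Y. Y \<subseteq> F \<Longrightarrow> \<bar>\<Sum>y\<in>Y. g y\<bar> \<le> C"
  shows "(\<Sum>y\<in>F. \<bar>g y\<bar>) \<le> 2 * C"
proof -
  have "(\<Sum>y\<in>F. \<bar>g y\<bar>) = (\<Sum>y\<in>{y\<in>F. g y \<ge> 0}. \<bar>g y\<bar>) + (\<Sum>y\<in>{y\<in>F. \<not> g y \<ge> 0}. \<bar>g y\<bar>)"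
    using assms(1) by (subst sum.union_disjoint[symmetric]) (auto intro!: sum.cong)
  also have "\<dots> = (\<Sum>y\<in>{y\<in>F. g y \<ge> 0}. g y) - (\<Sum>y\<in>{y\<in>F. \<not> g y \<ge> 0}. g y)"
    by (simp add: sum_negf[symmetric])
  also have "\<dots> \<le> 2 * C"
    using assms(2)[of "{y\<in>F. g y \<ge> 0}"] assms(2)[of "{y\<in>F. \<not> g y \<ge> 0}"] by auto
  finally show ?thesis .
qed

text \<open>
  The 4 sets of columns are those where the real or the imaginary part of the column sum has a given
  sign; on each of them the triangle inequality loses nothing for that part.
\<close>
lemma row_set_bound:
  assumes "finite F" and "rectangle_sums_bounded E D F C" and "X \<subseteq> D"
  shows "(\<Sum>y\<in>F. cmod (\<Sum>x\<in>X. E x y)) \<le> 4 * C"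
proof -
  let ?g = "\<lambda>y. \<Sum>x\<in>X. E x y"
  have rect: "cmod (\<Sum>y\<in>Y. ?g y) \<le> C" if "Y \<subseteq> F" for Y
    using assms(2,3) that by (subst sum.swap) (auto simp: rectangle_sums_bounded_def)
  have "(\<Sum>y\<in>F. cmod (?g y)) \<le> (\<Sum>y\<in>F. \<bar>Re (?g y)\<bar>) + (\<Sum>y\<in>F. \<bar>Im (?g y)\<bar>)"
    unfolding sum.distrib[symmetric] by (intro sum_mono cmod_le)
  also have "\<dots> \<le> 2 * C + 2 * C"
  proof (intro add_mono sum_abs_real_le[OF assms(1)])
    fix Y assume "Y \<subseteq> F"
    then show "\<bar>\<Sum>y\<in>Y. Re (?g y)\<bar> \<le> C" "\<bar>\<Sum>y\<in>Y. Im (?g y)\<bar> \<le> C"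
      using rect[of Y] abs_Re_le_cmod[of "\<Sum>y\<in>Y. ?g y"] abs_Im_le_cmod[of "\<Sum>y\<in>Y. ?g y"]
      unfolding Re_sum Im_sum by linarith+
  qed
  finally show ?thesis by simp
qed

text \<open>
  The weights split as \<open>w = c0 (u1 - u2 + \<i> (u3 - u4))\<close> with all \<open>u\<close> valued in \<open>[0, 1]\<close>, and by
  convexity each \<open>u\<close> behaves like the indicator of a set of rows.
\<close>
lemma weighted_row_bound:
  assumes "finite D" and "finite F" and "rectangle_sums_bounded E D F C"
    and "c0 > 0" and "\<And>x. x \<in> D \<Longrightarrow> cmod (w x) \<le> c0"
  shows "(\<Sum>y\<in>F. cmod (\<Sum>x\<in>D. w x * E x y)) \<le> 16 * c0 * C"
proof -
  define S where "S = (\<lambda>u y. \<Sum>x\<in>D. complex_of_real (u x) * E x y)"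
  have S: "(\<Sum>y\<in>F. cmod (S u y)) \<le> 4 * C" if "\<And>x. x \<in> D \<Longrightarrow> 0 \<le> u x \<and> u x \<le> (1 :: real)" for u
    using convex_weights_bound[OF assms(1), where F = F and h = "\<lambda>_. 0" and E = E and K = "4 * C" and w = u]
      row_set_bound[OF assms(2,3)] that by (simp add: S_def)
  define u1 u2 u3 u4 where "u1 = (\<lambda>x. max 0 (Re (w x)) / c0)" and "u2 = (\<lambda>x. max 0 (- Re (w x)) / c0)"
    and "u3 = (\<lambda>x. max 0 (Im (w x)) / c0)" and "u4 = (\<lambda>x. max 0 (- Im (w x)) / c0)"
  have le: "\<bar>Re (w x)\<bar> \<le> c0 \<and> \<bar>Im (w x)\<bar> \<le> c0" if "x \<in> D" for x
    using assms(5)[OF that] abs_Re_le_cmod[of "w x"] abs_Im_le_cmod[of "w x"] by linarith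
  have split: "w x = of_real c0 * (of_real (u1 x) - of_real (u2 x) + \<i> * (of_real (u3 x) - of_real (u4 x)))" for x
    using assms(4) by (auto simp: complex_eq_iff u1_def u2_def u3_def u4_def max_def)
  have "(\<Sum>x\<in>D. w x * E x y) = of_real c0 * (S u1 y - S u2 y + \<i> * (S u3 y - S u4 y))" for y
    by (simp add: split S_def sum_distrib_left sum.distrib sum_subtractf algebra_simps)
  then have "(\<Sum>y\<in>F. cmod (\<Sum>x\<in>D. w x * E x y)) = (\<Sum>y\<in>F. c0 * cmod (S u1 y - S u2 y + \<i> * (S u3 y - S u4 y)))"
    using assms(4) by (simp add: norm_mult)
  also have "\<dots> \<le> (\<Sum>y\<in>F. c0 * (cmod (S u1 y) + cmod (S u2 y) + (cmod (S u3 y) + cmod (S u4 y))))"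
  proof (intro sum_mono mult_left_mono)
    fix y
    have "cmod (\<i> * (S u3 y - S u4 y)) \<le> cmod (S u3 y) + cmod (S u4 y)"
      using norm_triangle_ineq4[of "S u3 y" "S u4 y"] by (simp add: norm_mult)
    then show "cmod (S u1 y - S u2 y + \<i> * (S u3 y - S u4 y)) \<le> cmod (S u1 y) + cmod (S u2 y) + (cmod (S u3 y) + cmod (S u4 y))"
      using norm_triangle_ineq[of "S u1 y - S u2 y" "\<i> * (S u3 y - S u4 y)"]
        norm_triangle_ineq4[of "S u1 y" "S u2 y"] by linarith
  qed (use assms(4) in simp)
  also have "\<dots> = c0 * ((\<Sum>y\<in>F. cmod (S u1 y)) + (\<Sum>y\<in>F. cmod (S u2 y)) + ((\<Sum>y\<in>F. cmod (S u3 y)) + (\<Sum>y\<in>F. cmod (S u4 y))))"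
    by (simp add: sum_distrib_left sum.distrib algebra_simps)
  also have "\<dots> \<le> c0 * (4 * C + 4 * C + (4 * C + 4 * C))"
    using assms(4) le
    by (intro mult_left_mono add_mono S) (force simp: u1_def u2_def u3_def u4_def max_def abs_le_iff)+
  finally show ?thesis by simp
qed

text \<open>
  The Gram matrix \<open>G\<close> of the columns is Hermitian, and its rows are sums of the columns weighted by
  entries of \<open>E\<close>, so that \<open>weighted_row_bound\<close> controls their absolute sums. For a Hermitian matrix a
  bound on absolute row sums bounds the quadratic form, by
  \<open>\<bar>v y\<bar> \<bar>v z\<bar> \<le> (\<bar>v y\<bar>\<^sup>2 + \<bar>v z\<bar>\<^sup>2) / 2\<close>.
\<close>
lemma rectangle_sums_operator_bound:
  fixes E :: "'a \<Rightarrow> 'b \<Rightarrow> complex"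
  assumes "finite D" and "finite F" and "rectangle_sums_bounded E D F C"
    and "c0 > 0" and "\<And>x y. x \<in> D \<Longrightarrow> y \<in> F \<Longrightarrow> cmod (E x y) \<le> c0"
  shows "L2_set (\<lambda>x. cmod (\<Sum>y\<in>F. E x y * v y)) D \<le> sqrt (16 * c0 * C) * L2_set (\<lambda>y. cmod (v y)) F"
proof -
  define G where "G = (\<lambda>y z. \<Sum>x\<in>D. E x y * cnj (E x z))"
  have G_sym: "cmod (G y z) = cmod (G z y)" for y z
  proof -
    have "G y z = cnj (G z y)" by (simp add: G_def mult.commute)
    then show ?thesis by simp
  qed
  have row: "(\<Sum>z\<in>F. cmod (G y z)) \<le> 16 * c0 * C" if "y \<in> F" for y
  proof -
    have "(\<Sum>z\<in>F. cmod (G z y)) \<le> 16 * c0 * C"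
      using weighted_row_bound[OF assms(1-4), of "\<lambda>x. cnj (E x y)"] assms(5) that
      by (simp add: G_def mult.commute)
    moreover have "(\<Sum>z\<in>F. cmod (G y z)) = (\<Sum>z\<in>F. cmod (G z y))"
      by (intro sum.cong refl G_sym)
    ultimately show ?thesis by simp
  qed
  have "complex_of_real (\<Sum>x\<in>D. (cmod (\<Sum>y\<in>F. E x y * v y))\<^sup>2) =
      (\<Sum>x\<in>D. \<Sum>y\<in>F. \<Sum>z\<in>F. E x y * v y * cnj (E x z * v z))"
    by (simp only: of_real_sum complex_norm_square cnj_sum sum_product)
  also have "\<dots> = (\<Sum>y\<in>F. \<Sum>x\<in>D. \<Sum>z\<in>F. E x y * v y * cnj (E x z * v z))"
    by (rule sum.swap)
  also have "\<dots> = (\<Sum>y\<in>F. \<Sum>z\<in>F. \<Sum>x\<in>D. E x y * v y * cnj (E x z * v z))"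
    by (intro sum.cong refl sum.swap)
  also have "\<dots> = (\<Sum>y\<in>F. \<Sum>z\<in>F. G y z * (v y * cnj (v z)))"
    by (simp add: G_def sum_distrib_left sum_distrib_right mult_ac)
  finally have "(\<Sum>x\<in>D. (cmod (\<Sum>y\<in>F. E x y * v y))\<^sup>2) = Re (\<Sum>y\<in>F. \<Sum>z\<in>F. G y z * (v y * cnj (v z)))"
    by (metis Re_complex_of_real)
  also have "\<dots> \<le> cmod (\<Sum>y\<in>F. \<Sum>z\<in>F. G y z * (v y * cnj (v z)))"
    by (rule complex_Re_le_cmod)
  also have "\<dots> \<le> (\<Sum>y\<in>F. \<Sum>z\<in>F. cmod (G y z * (v y * cnj (v z))))"
    by (intro sum_norm_le norm_sum)
  also have "\<dots> \<le> (\<Sum>y\<in>F. \<Sum>z\<in>F. cmod (G y z) * (((cmod (v y))\<^sup>2 + (cmod (v z))\<^sup>2) / 2))"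
  proof (intro sum_mono)
    fix y z
    have "cmod (v y) * cmod (v z) \<le> ((cmod (v y))\<^sup>2 + (cmod (v z))\<^sup>2) / 2"
      using sum_squares_bound[of "cmod (v y)" "cmod (v z)"] by simp
    then show "cmod (G y z * (v y * cnj (v z))) \<le> cmod (G y z) * (((cmod (v y))\<^sup>2 + (cmod (v z))\<^sup>2) / 2)"
      by (simp only: norm_mult complex_mod_cnj mult_left_mono norm_ge_zero)
  qed
  also have "\<dots> = (\<Sum>y\<in>F. \<Sum>z\<in>F. cmod (G y z) * (cmod (v y))\<^sup>2) / 2 + (\<Sum>y\<in>F. \<Sum>z\<in>F. cmod (G y z) * (cmod (v z))\<^sup>2) / 2"
    by (simp only: add_divide_distrib distrib_left sum.distrib sum_divide_distrib times_divide_eq_right)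
  also have "(\<Sum>y\<in>F. \<Sum>z\<in>F. cmod (G y z) * (cmod (v z))\<^sup>2) = (\<Sum>y\<in>F. \<Sum>z\<in>F. cmod (G y z) * (cmod (v y))\<^sup>2)"
    proof -
    have "(\<Sum>y\<in>F. \<Sum>z\<in>F. cmod (G y z) * (cmod (v z))\<^sup>2) = (\<Sum>z\<in>F. \<Sum>y\<in>F. cmod (G y z) * (cmod (v z))\<^sup>2)"
      by (rule sum.swap)
    also have "\<dots> = (\<Sum>z\<in>F. \<Sum>y\<in>F. cmod (G z y) * (cmod (v z))\<^sup>2)"
      by (intro sum.cong refl arg_cong2[of _ _ _ _ "(*)"] G_sym)
    finally show ?thesis .
  qed
  also have "(\<Sum>y\<in>F. \<Sum>z\<in>F. cmod (G y z) * (cmod (v y))\<^sup>2) \<le> (\<Sum>y\<in>F. 16 * c0 * C * (cmod (v y))\<^sup>2)"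
    using row by (intro sum_mono) (simp add: sum_distrib_right[symmetric] mult_right_mono)
  also have "\<dots> = 16 * c0 * C * (\<Sum>y\<in>F. (cmod (v y))\<^sup>2)" by (simp add: sum_distrib_left)
  finally have "(\<Sum>x\<in>D. (cmod (\<Sum>y\<in>F. E x y * v y))\<^sup>2) \<le> 16 * c0 * C * (\<Sum>y\<in>F. (cmod (v y))\<^sup>2)" by linarith
  then show ?thesis unfolding L2_set_def real_sqrt_mult[symmetric] by (rule real_sqrt_le_mono)
qed

section \<open>Equitable maps\<close>

definition equitable :: "'a set \<Rightarrow> ('a \<Rightarrow> nat) \<Rightarrow> nat \<Rightarrow> nat \<Rightarrow> bool" where
  "equitable D f m p \<longleftrightarrow> finite D \<and> f ` D \<subseteq> {..<m} \<and> (\<forall>i<m. card {x \<in> D. f x = i} = p)"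

lemma equitable_finite: "equitable D f m p \<Longrightarrow> finite D"
  by (simp add: equitable_def)

lemma equitable_less: "equitable D f m p \<Longrightarrow> x \<in> D \<Longrightarrow> f x < m"
  by (auto simp: equitable_def)

lemma equitable_sum:
  fixes g :: "nat \<Rightarrow> 'b :: semiring_1"
  assumes "equitable D f m p"
  shows "(\<Sum>x\<in>D. g (f x)) = of_nat p * (\<Sum>i<m. g i)"
proof -
  have "(\<Sum>x\<in>D. g (f x)) = (\<Sum>i<m. \<Sum>x\<in>{x \<in> D. f x = i}. g (f x))"
    using assms by (intro sum.group[symmetric]) (auto simp: equitable_def)
  also have "\<dots> = (\<Sum>i<m. of_nat p * g i)"
    using assms by (intro sum.cong) (auto simp: equitable_def)
  finally show ?thesis by (simp add: sum_distrib_left)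
qed

lemma equitable_card:
  assumes "equitable D f m p"
  shows "card D = m * p"
  using equitable_sum[OF assms, of "\<lambda>_. 1 :: nat"] by simp

lemma equitable_L2_set:
  assumes "equitable D f m p" and "c \<ge> 0" and "v \<in> carrier_vec m"
  shows "L2_set (\<lambda>x. c * cmod (v $ f x)) D = c * sqrt p * vec_norm2 v"
proof -
  have "(\<Sum>x\<in>D. (c * cmod (v $ f x))\<^sup>2) = p * (\<Sum>i<m. (c * cmod (v $ i))\<^sup>2)"
    using equitable_sum[OF assms(1), of "\<lambda>i. (c * cmod (v $ i))\<^sup>2"] by simp
  also have "\<dots> = (c * sqrt p * vec_norm2 v)\<^sup>2"
    using assms(3) by (simp add: power_mult_distrib vec_norm2_squared sum_distrib_left mult_ac)
  finally show ?thesis using assms(2) by (simp add: L2_set_def)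
qed

text \<open>
  Couplings of different sizes can be placed side by side.
\<close>
lemma equitable_Sigma:
  assumes "finite I" and "\<And>u. u \<in> I \<Longrightarrow> equitable (D u) (f u) m (p u)"
  shows "equitable (Sigma I D) (\<lambda>(u, x). f u x) m (\<Sum>u\<in>I. p u)"
  unfolding equitable_def
proof (intro conjI allI impI)
  show "finite (Sigma I D)" using assms by (auto simp: equitable_def)
  show "(\<lambda>(u, x). f u x) ` Sigma I D \<subseteq> {..<m}" using assms(2) by (force simp: equitable_def)
  fix i assume "i < m"
  have "{z \<in> Sigma I D. (case z of (u, x) \<Rightarrow> f u x) = i} = Sigma I (\<lambda>u. {x \<in> D u. f u x = i})" by auto
  then have "card {z \<in> Sigma I D. (case z of (u, x) \<Rightarrow> f u x) = i} = (\<Sum>u\<in>I. card {x \<in> D u. f u x = i})"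
    using assms by (simp add: equitable_def)
  also have "\<dots> = (\<Sum>u\<in>I. p u)" using assms(2) \<open>i < m\<close> by (intro sum.cong) (auto simp: equitable_def)
  finally show "card {z \<in> Sigma I D. (case z of (u, x) \<Rightarrow> f u x) = i} = (\<Sum>u\<in>I. p u)" .
qed

lemma equitable_div:
  assumes "N = m * p"
  shows "equitable {..<N} (\<lambda>x. x div p) m p"
  unfolding equitable_def
proof (intro conjI allI impI)
  show "(\<lambda>x. x div p) ` {..<N} \<subseteq> {..<m}"
    using assms by (auto simp: less_mult_imp_div_less)
  fix i assume i: "i < m"
  have "{x \<in> {..<N}. x div p = i} = {i * p..<Suc i * p}"
  proof (cases "p = 0")
    case False
    have "Suc i * p \<le> m * p" using i by (intro mult_le_mono1) simp
    then show ?thesis using assms False by (auto simp: mult.commute dividend_less_times_div intro: div_nat_eqI)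
  qed (simp add: assms)
  then show "card {x \<in> {..<N}. x div p = i} = p" by simp
qed simp

lemma equitable_permute:
  assumes "equitable D f m p" and "\<pi> permutes D"
  shows "equitable D (\<lambda>x. f (\<pi> x)) m p"
  unfolding equitable_def
proof (intro conjI allI impI)
  show "finite D" using assms(1) by (rule equitable_finite)
  show "(\<lambda>x. f (\<pi> x)) ` D \<subseteq> {..<m}"
    using equitable_less[OF assms(1)] permutes_in_image[OF assms(2)] by auto
  fix i assume "i < m"
  have "bij_betw \<pi> {x \<in> D. f (\<pi> x) = i} {x \<in> D. f x = i}"
    using permutes_imp_bij[OF assms(2)] unfolding bij_betw_def by (auto intro: inj_on_subset)
  then have "card {x \<in> D. f (\<pi> x) = i} = card {x \<in> D. f x = i}" by (rule bij_betw_same_card)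
  then show "card {x \<in> D. f (\<pi> x) = i} = p" using assms(1) \<open>i < m\<close> by (simp add: equitable_def)
qed

text \<open>
  Numbering the fibres consecutively identifies \<open>f\<close> with the map from the indices of a blow-up to
  those of the original matrix.
\<close>
lemma equitable_enumeration:
  assumes "equitable D f m p"
  shows "\<exists>h. bij_betw h D {..<m * p} \<and> (\<forall>x\<in>D. h x div p = f x)"
proof -
  have "\<exists>g. bij_betw g {x \<in> D. f x = i} {..<p}" if "i < m" for i
    using assms that finite_same_card_bij[of "{x \<in> D. f x = i}" "{..<p}"] by (auto simp: equitable_def)
  then obtain g where g: "\<And>i. i < m \<Longrightarrow> bij_betw (g i) {x \<in> D. f x = i} {..<p}" by metis
  define h where "h = (\<lambda>x. f x * p + g (f x) x)"
  have g_less: "g (f x) x < p" if "x \<in> D" for x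
    using g[OF equitable_less[OF assms that]] that by (auto simp: bij_betw_def)
  have h_div: "h x div p = f x" if "x \<in> D" for x
    using g_less[OF that] by (simp add: h_def)
  have inj: "inj_on h D"
  proof (rule inj_onI)
    fix x y assume xy: "x \<in> D" "y \<in> D" "h x = h y"
    then have f: "f x = f y" using h_div by metis
    then have "g (f x) x = g (f x) y" using xy(3) by (simp add: h_def)
    then show "x = y"
      using g[OF equitable_less[OF assms xy(1)]] xy(1,2) f by (auto simp: bij_betw_def dest: inj_onD)
  qed
  have sub: "h ` D \<subseteq> {..<m * p}"
  proof
    fix z assume "z \<in> h ` D"
    then obtain x where x: "x \<in> D" "z = h x" by blast
    have "h x < Suc (f x) * p" using g_less[OF x(1)] by (simp add: h_def)
    also have "\<dots> \<le> m * p" using equitable_less[OF assms x(1)] by (intro mult_le_mono1) simp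
    finally show "z \<in> {..<m * p}" using x by simp
  qed
  have "card (h ` D) = m * p" using inj equitable_card[OF assms] by (simp add: card_image)
  then have "h ` D = {..<m * p}" using sub by (intro card_subset_eq) auto
  then show ?thesis using inj h_div by (auto simp: bij_betw_def)
qed

section \<open>Singular values of coupled matrices\<close>

lemma sum_cmod_squared_le:
  "(\<Sum>x\<in>X. cmod (f x))\<^sup>2 \<le> (\<Sum>x\<in>X. (cmod (f x))\<^sup>2) * card X"
proof -
  have "(\<Sum>x\<in>X. cmod (f x)) \<le> L2_set (\<lambda>x. cmod (f x)) X * sqrt (card X)"
    using L2_set_mult_ineq[of "\<lambda>x. cmod (f x)" "\<lambda>_. 1" X]
    by (cases "finite X") (simp_all add: L2_set_constant)
  then have "(\<Sum>x\<in>X. cmod (f x))\<^sup>2 \<le> (L2_set (\<lambda>x. cmod (f x)) X * sqrt (card X))\<^sup>2"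
    by (intro power_mono sum_nonneg) simp_all
  also have "\<dots> = (\<Sum>x\<in>X. (cmod (f x))\<^sup>2) * card X"
    by (simp add: power_mult_distrib L2_set_def sum_nonneg)
  finally show ?thesis .
qed

text \<open>
  The map \<open>T\<close> lifts a vector along \<open>a'\<close> and sums it over the fibres of \<open>b'\<close>; its entries count the
  common points of the fibres. The lift multiplies norms by \<open>sqrt q\<close>, and summation over fibres of
  size \<open>q'\<close> multiplies them by at most \<open>sqrt q'\<close>, by the Cauchy-Schwarz inequality. The factors
  combine to the normalizations of the two singular values because \<open>m p = r p'\<close> and \<open>n q = s q'\<close>.
\<close>
lemma coupling_singular_value_le:
  fixes A B :: "complex mat"
  assumes A: "A \<in> carrier_mat m n" and B: "B \<in> carrier_mat r s"
    and a: "equitable D a m p" and b: "equitable D b r p'"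
    and a': "equitable F a' n q" and b': "equitable F b' s q'"
    and nonempty: "D \<noteq> {}" "F \<noteq> {}"
    and op: "\<And>v. L2_set (\<lambda>x. cmod (\<Sum>y\<in>F. (A $$ (a x, a' y) - B $$ (b x, b' y)) * v y)) D
      \<le> \<epsilon> * sqrt (real (card D) * real (card F)) * L2_set (\<lambda>y. cmod (v y)) F"
    and l: "l < n" "l < s"
  shows "singular_values A ! l / sqrt (real m * real n) \<le> singular_values B ! l / sqrt (real r * real s) + \<epsilon>"
proof -
  define \<Delta> where "\<Delta> = sqrt (real (card D) * real (card F))"
  note fin = equitable_finite[OF a] equitable_finite[OF a']
  have card: "card D = m * p" "card D = r * p'" "card F = n * q" "card F = s * q'"
    using equitable_card a b a' b' by blast+
  have "card D > 0" "card F > 0" using fin nonempty by (simp_all add: card_gt_0_iff)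
  then have pos: "m > 0" "p > 0" "r > 0" "p' > 0" "n > 0" "q > 0" "s > 0" "q' > 0"
    using card by (metis nat_0_less_mult_iff)+
  define T where "T = mat s n (\<lambda>(j, i). complex_of_nat (card {y \<in> F. b' y = j \<and> a' y = i}))"
  have T: "T \<in> carrier_mat s n" by (simp add: T_def)
  have T_index: "(T *\<^sub>v u) $ j = (\<Sum>y\<in>{y \<in> F. b' y = j}. u $ a' y)"
    if u: "u \<in> carrier_vec n" and j: "j < s" for u j
  proof -
    have "(\<Sum>y\<in>{y \<in> F. b' y = j}. u $ a' y) =
        (\<Sum>i<n. \<Sum>y\<in>{y \<in> {y \<in> F. b' y = j}. a' y = i}. u $ a' y)"
      using a' by (intro sum.group[symmetric]) (auto simp: equitable_def)
    also have "\<dots> = (\<Sum>i<n. of_nat (card {y \<in> F. b' y = j \<and> a' y = i}) * u $ i)"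
    proof (intro sum.cong refl)
      fix i
      have "(\<Sum>y\<in>{y \<in> {y \<in> F. b' y = j}. a' y = i}. u $ a' y) =
        (\<Sum>y\<in>{y \<in> F. b' y = j \<and> a' y = i}. u $ i)" by (intro sum.cong) auto
      then show "(\<Sum>y\<in>{y \<in> {y \<in> F. b' y = j}. a' y = i}. u $ a' y) =
        of_nat (card {y \<in> F. b' y = j \<and> a' y = i}) * u $ i" by simp
    qed
    also have "\<dots> = (T *\<^sub>v u) $ j"
      using u j by (simp add: T_def scalar_prod_def lessThan_atLeast0)
    finally show ?thesis by simp
  qed
  have lift_norm: "L2_set (\<lambda>y. cmod (u $ a' y)) F = sqrt q * vec_norm2 u"
    if "u \<in> carrier_vec n" for u
    using equitable_L2_set[OF a' _ that, of 1] by simp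
  have T_bound: "vec_norm2 (T *\<^sub>v u) \<le> sqrt (real q * real q') * vec_norm2 u"
    if u: "u \<in> carrier_vec n" for u
  proof (rule power2_le_imp_le)
    have "(vec_norm2 (T *\<^sub>v u))\<^sup>2 = (\<Sum>j<s. (cmod (\<Sum>y\<in>{y \<in> F. b' y = j}. u $ a' y))\<^sup>2)"
      unfolding vec_norm2_squared using T T_index[OF u] by simp
    also have "\<dots> \<le> (\<Sum>j<s. q' * (\<Sum>y\<in>{y \<in> F. b' y = j}. (cmod (u $ a' y))\<^sup>2))"
    proof (rule sum_mono)
      fix j assume "j \<in> {..<s}"
      then have "card {y \<in> F. b' y = j} = q'" using b' by (simp add: equitable_def)
      moreover have "(cmod (\<Sum>y\<in>{y \<in> F. b' y = j}. u $ a' y))\<^sup>2 \<le> (\<Sum>y\<in>{y \<in> F. b' y = j}. cmod (u $ a' y))\<^sup>2"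
        by (intro power_mono norm_sum) simp
      moreover have "(\<Sum>y\<in>{y \<in> F. b' y = j}. cmod (u $ a' y))\<^sup>2 \<le>
          (\<Sum>y\<in>{y \<in> F. b' y = j}. (cmod (u $ a' y))\<^sup>2) * card {y \<in> F. b' y = j}"
        by (rule sum_cmod_squared_le)
      ultimately show "(cmod (\<Sum>y\<in>{y \<in> F. b' y = j}. u $ a' y))\<^sup>2 \<le>
          q' * (\<Sum>y\<in>{y \<in> F. b' y = j}. (cmod (u $ a' y))\<^sup>2)" by (simp add: mult.commute)
    qed
    also have "\<dots> = q' * (\<Sum>y\<in>F. (cmod (u $ a' y))\<^sup>2)"
    proof -
      have "(\<Sum>j<s. \<Sum>y\<in>{y \<in> F. b' y = j}. (cmod (u $ a' y))\<^sup>2) = (\<Sum>y\<in>F. (cmod (u $ a' y))\<^sup>2)"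
        using b' by (intro sum.group) (auto simp: equitable_def)
      then show ?thesis by (simp only: sum_distrib_left[symmetric])
    qed
    also have "(\<Sum>y\<in>F. (cmod (u $ a' y))\<^sup>2) = (sqrt q * vec_norm2 u)\<^sup>2"
      unfolding lift_norm[OF u, symmetric] L2_set_def by (simp add: sum_nonneg)
    also have "q' * (sqrt q * vec_norm2 u)\<^sup>2 = (sqrt (real q * real q') * vec_norm2 u)\<^sup>2"
      by (simp add: power_mult_distrib)
    finally show "(vec_norm2 (T *\<^sub>v u))\<^sup>2 \<le> (sqrt (real q * real q') * vec_norm2 u)\<^sup>2" .
  qed simp
  have bound: "q * sqrt p * vec_norm2 (A *\<^sub>v u) \<le> sqrt p' * vec_norm2 (B *\<^sub>v (T *\<^sub>v u)) + \<epsilon> * \<Delta> * sqrt q * vec_norm2 u"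
    if u: "u \<in> carrier_vec n" for u
  proof -
    note Tu = mult_mat_vec_carrier[OF T u]
    define Ev where "Ev = (\<lambda>x. \<Sum>y\<in>F. (A $$ (a x, a' y) - B $$ (b x, b' y)) * u $ a' y)"
    have Ev: "Ev x = of_nat q * (A *\<^sub>v u) $ a x - (B *\<^sub>v (T *\<^sub>v u)) $ b x" if x: "x \<in> D" for x
    proof -
      have ab: "a x < m" "b x < r" using equitable_less[OF a x] equitable_less[OF b x] by simp_all
      have "(\<Sum>y\<in>F. A $$ (a x, a' y) * u $ a' y) = of_nat q * (\<Sum>i<n. A $$ (a x, i) * u $ i)"
        by (rule equitable_sum[OF a'])
      also have "\<dots> = of_nat q * (A *\<^sub>v u) $ a x"
        using ab A u by (simp add: scalar_prod_def lessThan_atLeast0)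
      finally have 1: "(\<Sum>y\<in>F. A $$ (a x, a' y) * u $ a' y) = of_nat q * (A *\<^sub>v u) $ a x" .
      have "(\<Sum>y\<in>F. B $$ (b x, b' y) * u $ a' y) =
          (\<Sum>j<s. \<Sum>y\<in>{y \<in> F. b' y = j}. B $$ (b x, b' y) * u $ a' y)"
        using b' by (intro sum.group[symmetric]) (auto simp: equitable_def)
      also have "\<dots> = (\<Sum>j<s. B $$ (b x, j) * (T *\<^sub>v u) $ j)"
        using T_index[OF u] by (intro sum.cong refl) (simp add: sum_distrib_left)
      also have "\<dots> = (B *\<^sub>v (T *\<^sub>v u)) $ b x"
        using ab B Tu T by (simp add: scalar_prod_def lessThan_atLeast0)
      finally show ?thesis unfolding Ev_def left_diff_distrib sum_subtractf 1 by simp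
    qed
    have "q * sqrt p * vec_norm2 (A *\<^sub>v u) = L2_set (\<lambda>x. q * cmod ((A *\<^sub>v u) $ a x)) D"
      by (rule equitable_L2_set[OF a, symmetric]) (use A u in auto)
    also have "\<dots> \<le> L2_set (\<lambda>x. cmod ((B *\<^sub>v (T *\<^sub>v u)) $ b x) + cmod (Ev x)) D"
    proof (rule L2_set_mono)
      fix x assume x: "x \<in> D"
      have "q * cmod ((A *\<^sub>v u) $ a x) = cmod ((B *\<^sub>v (T *\<^sub>v u)) $ b x + Ev x)"
        unfolding Ev[OF x] by (simp add: norm_mult)
      then show "q * cmod ((A *\<^sub>v u) $ a x) \<le> cmod ((B *\<^sub>v (T *\<^sub>v u)) $ b x) + cmod (Ev x)"
        by (simp add: norm_triangle_ineq)
    qed simp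
    also have "\<dots> \<le> L2_set (\<lambda>x. cmod ((B *\<^sub>v (T *\<^sub>v u)) $ b x)) D + L2_set (\<lambda>x. cmod (Ev x)) D"
      by (rule L2_set_triangle_ineq)
    also have "L2_set (\<lambda>x. cmod ((B *\<^sub>v (T *\<^sub>v u)) $ b x)) D = sqrt p' * vec_norm2 (B *\<^sub>v (T *\<^sub>v u))"
      using equitable_L2_set[OF b, of 1 "B *\<^sub>v (T *\<^sub>v u)"] mult_mat_vec_carrier[OF B Tu] by simp
    also have "L2_set (\<lambda>x. cmod (Ev x)) D \<le> \<epsilon> * \<Delta> * (sqrt q * vec_norm2 u)"
      using op[of "\<lambda>y. u $ a' y"] by (simp only: Ev_def \<Delta>_def lift_norm[OF u])
    finally show ?thesis by (simp add: mult.assoc)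
  qed
  have "q * sqrt p / sqrt p' * singular_values A ! l \<le>
      sqrt (real q * real q') * singular_values B ! l + \<epsilon> * \<Delta> * sqrt q / sqrt p'"
  proof (rule singular_value_transfer[OF A B T l _ _ T_bound])
    fix u :: "complex vec" assume "u \<in> carrier_vec n"
    from bound[OF this] show "q * sqrt p / sqrt p' * vec_norm2 (A *\<^sub>v u) \<le>
        vec_norm2 (B *\<^sub>v (T *\<^sub>v u)) + \<epsilon> * \<Delta> * sqrt q / sqrt p' * vec_norm2 u"
      using pos by (simp add: field_simps)
  qed simp_all
  then have "q * sqrt p * singular_values A ! l \<le>
      sqrt p' * sqrt (real q * real q') * singular_values B ! l + \<epsilon> * \<Delta> * sqrt q"
    using pos by (simp add: field_simps)
  also have "q * sqrt p = sqrt q * \<Delta> / sqrt (real m * real n)"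
    using pos unfolding \<Delta>_def card(1,3) by (simp add: real_sqrt_mult field_simps)
  also have "sqrt p' * sqrt (real q * real q') = sqrt q * \<Delta> / sqrt (real r * real s)"
    using pos unfolding \<Delta>_def card(2,4) by (simp add: real_sqrt_mult field_simps)
  finally have "sqrt q * \<Delta> * (singular_values A ! l / sqrt (real m * real n)) \<le>
      sqrt q * \<Delta> * (singular_values B ! l / sqrt (real r * real s) + \<epsilon>)"
    by (simp add: algebra_simps)
  moreover have "sqrt q * \<Delta> > 0"
    using pos \<open>card D > 0\<close> \<open>card F > 0\<close> by (simp add: \<Delta>_def)
  ultimately show ?thesis by (rule mult_left_le_imp_le)
qed

text \<open>
  Exchanging the roles of the two matrices only changes the sign of the difference matrix. The constant
  is \<open>32 = 16 * 2\<close>, where 2 bounds the entries of the difference matrix.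
\<close>
lemma coupling_singular_values:
  fixes A B :: "complex mat"
  assumes A: "A \<in> carrier_mat m n" and B: "B \<in> carrier_mat r s"
    and a: "equitable D a m p" and b: "equitable D b r p'"
    and a': "equitable F a' n q" and b': "equitable F b' s q'"
    and nonempty: "D \<noteq> {}" "F \<noteq> {}"
    and entries: "\<And>i j. i < m \<Longrightarrow> j < n \<Longrightarrow> cmod (A $$ (i, j)) \<le> 1"
      "\<And>i j. i < r \<Longrightarrow> j < s \<Longrightarrow> cmod (B $$ (i, j)) \<le> 1"
    and rect: "rectangle_sums_bounded (\<lambda>x y. A $$ (a x, a' y) - B $$ (b x, b' y)) D F
      (\<delta> * (real (card D) * real (card F)))"
    and l: "l < n" "l < s"
  shows "\<bar>singular_values A ! l / sqrt (real m * real n) - singular_values B ! l / sqrt (real r * real s)\<bar>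
    \<le> sqrt (32 * \<delta>)"
proof -
  let ?E = "\<lambda>x y. A $$ (a x, a' y) - B $$ (b x, b' y)"
  let ?N = "real (card D) * real (card F)"
  have "cmod (?E x y) \<le> 2" if "x \<in> D" "y \<in> F" for x y
    using entries(1)[of "a x" "a' y"] entries(2)[of "b x" "b' y"] that
      norm_triangle_ineq4[of "A $$ (a x, a' y)" "B $$ (b x, b' y)"]
      equitable_less[OF a] equitable_less[OF b] equitable_less[OF a'] equitable_less[OF b'] by fastforce
  then have "L2_set (\<lambda>x. cmod (\<Sum>y\<in>F. ?E x y * v y)) D \<le>
      sqrt (16 * 2 * (\<delta> * ?N)) * L2_set (\<lambda>y. cmod (v y)) F" for v
    by (intro rectangle_sums_operator_bound[OF equitable_finite[OF a] equitable_finite[OF a'] rect]) auto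
  moreover have "sqrt (16 * 2 * (\<delta> * ?N)) = sqrt (32 * \<delta>) * sqrt ?N"
    by (simp add: real_sqrt_mult mult.assoc)
  ultimately have op: "L2_set (\<lambda>x. cmod (\<Sum>y\<in>F. ?E x y * v y)) D \<le>
      sqrt (32 * \<delta>) * sqrt ?N * L2_set (\<lambda>y. cmod (v y)) F" for v by (simp only:)
  have op': "L2_set (\<lambda>x. cmod (\<Sum>y\<in>F. (B $$ (b x, b' y) - A $$ (a x, a' y)) * v y)) D \<le>
      sqrt (32 * \<delta>) * sqrt ?N * L2_set (\<lambda>y. cmod (v y)) F" for v
  proof -
    have "(\<Sum>y\<in>F. (B $$ (b x, b' y) - A $$ (a x, a' y)) * v y) = - (\<Sum>y\<in>F. ?E x y * v y)" for x
      by (simp add: sum_negf[symmetric] algebra_simps)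
    then show ?thesis using op[of v] by simp
  qed
  show ?thesis
    using coupling_singular_value_le[OF A B a b a' b' nonempty op l]
      coupling_singular_value_le[OF B A b a b' a' nonempty op' l(2,1)] by linarith
qed

section \<open>The cut norm and permutations in terms of sums over rectangles\<close>

text \<open>
  \<open>pick\<close> enumerates the set in increasing order, so counting the smaller elements inverts it.
\<close>
lemma bij_betw_pick:
  assumes "finite X"
  shows "bij_betw (pick X) {0..<card X} X"
proof -
  have inj: "inj_on (pick X) {0..<card X}"
    by (rule inj_on_inverseI[of _ "\<lambda>x. card {a \<in> X. a < x}"]) (simp add: card_pick_le)
  have "pick X ` {0..<card X} \<subseteq> X" using pick_in_set_le by auto
  moreover have "card (pick X ` {0..<card X}) = card X" using inj by (simp add: card_image)
  ultimately have "pick X ` {0..<card X} = X" using assms by (intro card_subset_eq) auto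
  with inj show ?thesis by (simp add: bij_betw_def)
qed

lemma sum_mat_submatrix:
  assumes "X \<subseteq> {..<dim_row M}" and "Y \<subseteq> {..<dim_col M}"
  shows "sum_mat (submatrix M X Y) = (\<Sum>i\<in>X. \<Sum>j\<in>Y. M $$ (i, j))"
proof -
  have X: "{i. i < dim_row M \<and> i \<in> X} = X" and Y: "{j. j < dim_col M \<and> j \<in> Y} = Y"
    using assms by auto
  have fin: "finite X" "finite Y" using assms finite_subset by blast+
  have "sum_mat (submatrix M X Y) = (\<Sum>i\<in>{0..<card X}. \<Sum>j\<in>{0..<card Y}. M $$ (pick X i, pick Y j))"
    unfolding sum_mat_def sum.cartesian_product
    by (intro sum.cong) (auto simp: submatrix_def X Y)
  also have "\<dots> = (\<Sum>i\<in>{0..<card X}. \<Sum>j\<in>Y. M $$ (pick X i, j))"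
    by (intro sum.cong refl sum.reindex_bij_betw bij_betw_pick fin)
  also have "\<dots> = (\<Sum>i\<in>X. \<Sum>j\<in>Y. M $$ (i, j))"
    by (rule sum.reindex_bij_betw[OF bij_betw_pick[OF fin(1)]])
  finally show ?thesis .
qed

lemma cut_norm_le_iff:
  assumes "M \<in> carrier_mat d e" and "d > 0" and "e > 0"
  shows "cut_norm M \<le> c \<longleftrightarrow>
    rectangle_sums_bounded (\<lambda>i j. M $$ (i, j)) {..<d} {..<e} (c * (real d * real e))"
proof -
  let ?f = "\<lambda>X Y. 1 / (real d * real e) * cmod (sum_mat (submatrix M X Y))"
  have dim: "dim_row M = d" "dim_col M = e" using assms by auto
  let ?S = "{?f X Y | X Y. X \<subseteq> {..<d} \<and> Y \<subseteq> {..<e}}"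
  have "?S = (\<lambda>(X, Y). ?f X Y) ` (Pow {..<d} \<times> Pow {..<e})" by auto
  then have fin: "finite ?S" by simp
  have "?f {} {} \<in> ?S" by blast
  then have ne: "?S \<noteq> {}" by blast
  have "cut_norm M \<le> c \<longleftrightarrow> (\<forall>z\<in>?S. z \<le> c)"
    unfolding cut_norm_def dim using Max_le_iff[OF fin ne] by simp
  also have "\<dots> \<longleftrightarrow> (\<forall>X Y. X \<subseteq> {..<d} \<and> Y \<subseteq> {..<e} \<longrightarrow> ?f X Y \<le> c)" by blast
  also have "\<dots> \<longleftrightarrow> rectangle_sums_bounded (\<lambda>i j. M $$ (i, j)) {..<d} {..<e} (c * (real d * real e))"
    unfolding rectangle_sums_bounded_def
    using assms sum_mat_submatrix[of _ M] by (auto simp: dim field_simps)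
  finally show ?thesis .
qed

lemma permutation_mat_mult_index:
  fixes N :: "complex mat"
  assumes N: "N \<in> carrier_mat d e" and "\<pi> permutes {..<d}" and "\<tau> permutes {..<e}" and "i < d" "j < e"
  shows "(mat d d (\<lambda>(i, j). if j = \<pi> i then 1 else 0) * N * mat e e (\<lambda>(i, j). if j = \<tau> i then 1 else 0)) $$ (i, j)
    = N $$ (\<pi> i, inv_into UNIV \<tau> j)"
proof -
  have in_range: "\<pi> i < d" "inv_into UNIV \<tau> j < e"
    using assms permutes_in_image[of \<pi>] permutes_in_image[OF permutes_inv[OF assms(3)]] by auto
  have "(mat d d (\<lambda>(i, j). if j = \<pi> i then 1 else 0) * N) $$ (i, l) = N $$ (\<pi> i, l)" if "l < e" for l
  proof -
    have "(mat d d (\<lambda>(i, j). if j = \<pi> i then 1 else 0) * N) $$ (i, l) =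
        (\<Sum>k<d. (if k = \<pi> i then 1 else 0) * N $$ (k, l))"
      using assms that by (simp add: scalar_prod_def lessThan_atLeast0)
    also have "\<dots> = (\<Sum>k<d. if k = \<pi> i then N $$ (k, l) else 0)" by (intro sum.cong) auto
    finally show ?thesis using in_range by simp
  qed
  moreover have "(mat d d (\<lambda>(i, j). if j = \<pi> i then 1 else 0) * N * mat e e (\<lambda>(i, j). if j = \<tau> i then 1 else 0)) $$ (i, j) =
      (\<Sum>l<e. (mat d d (\<lambda>(i, j). if j = \<pi> i then 1 else 0) * N) $$ (i, l) * (if j = \<tau> l then 1 else 0))"
    using assms by (simp add: scalar_prod_def lessThan_atLeast0)
  ultimately have "(mat d d (\<lambda>(i, j). if j = \<pi> i then 1 else 0) * N * mat e e (\<lambda>(i, j). if j = \<tau> i then 1 else 0)) $$ (i, j) =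
      (\<Sum>l<e. N $$ (\<pi> i, l) * (if j = \<tau> l then 1 else 0))" by simp
  also have "\<dots> = (\<Sum>l<e. if l = inv_into UNIV \<tau> j then N $$ (\<pi> i, l) else 0)"
    using permutes_inverses[OF assms(3)] by (intro sum.cong) auto
  finally show ?thesis using in_range by simp
qed

lemma finite_permutation_mats: "finite (permutation_mats d)"
proof -
  have "permutation_mats d = (\<lambda>\<pi>. mat d d (\<lambda>(i, j). if j = \<pi> i then 1 else 0)) ` {\<pi>. \<pi> permutes {..<d}}"
    by (auto simp: permutation_mats_def)
  then show ?thesis by (simp add: finite_permutations)
qed

lemma cut_norm_permuted_le_iff:
  fixes M N :: "complex mat"
  assumes M: "M \<in> carrier_mat d e" and N: "N \<in> carrier_mat d e" and "d > 0" "e > 0"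
    and \<pi>: "\<pi> permutes {..<d}" and \<tau>: "\<tau> permutes {..<e}"
  shows "cut_norm (M - mat d d (\<lambda>(i, j). if j = \<pi> i then 1 else 0) * N * mat e e (\<lambda>(i, j). if j = \<tau> i then 1 else 0)) \<le> c \<longleftrightarrow>
    rectangle_sums_bounded (\<lambda>i j. M $$ (i, j) - N $$ (\<pi> i, inv_into UNIV \<tau> j)) {..<d} {..<e} (c * (real d * real e))"
proof -
  let ?R = "mat d d (\<lambda>(i, j). if j = \<pi> i then 1 else 0) * N * mat e e (\<lambda>(i, j). if j = \<tau> i then 1 else 0)"
  have R: "?R \<in> carrier_mat d e" by (intro carrier_matI) simp_all
  have MR: "M - ?R \<in> carrier_mat d e" using R by (rule minus_carrier_mat)
  show ?thesis
    unfolding cut_norm_le_iff[OF MR assms(3,4)]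
  proof (rule rectangle_sums_bounded_cong)
    fix i j assume "i \<in> {..<d}" "j \<in> {..<e}"
    then show "(M - ?R) $$ (i, j) = M $$ (i, j) - N $$ (\<pi> i, inv_into UNIV \<tau> j)"
      using M R permutation_mat_mult_index[OF N \<pi> \<tau>, of i j] by (subst index_minus_mat) auto
  qed
qed

text \<open>
  The inverse that comes with right multiplication by a permutation matrix disappears in the
  quantification over all permutations.
\<close>
lemma cut_distance_same_size_props:
  fixes M N :: "complex mat"
  assumes M: "M \<in> carrier_mat d e" and N: "N \<in> carrier_mat d e" and pos: "d > 0" "e > 0"
  shows cut_distance_same_size_attained: "\<exists>\<pi> \<tau>. \<pi> permutes {..<d} \<and> \<tau> permutes {..<e} \<and>
      rectangle_sums_bounded (\<lambda>i j. M $$ (i, j) - N $$ (\<pi> i, \<tau> j)) {..<d} {..<e}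
        (cut_distance_same_size M N * (real d * real e))"
    and cut_distance_same_size_le: "\<lbrakk>\<pi> permutes {..<d}; \<tau> permutes {..<e};
      rectangle_sums_bounded (\<lambda>i j. M $$ (i, j) - N $$ (\<pi> i, \<tau> j)) {..<d} {..<e} (c * (real d * real e))\<rbrakk>
      \<Longrightarrow> cut_distance_same_size M N \<le> c"
proof -
  let ?mat = "\<lambda>d \<pi>. mat d d (\<lambda>(i, j). if j = \<pi> i then 1 else 0) :: complex mat"
  let ?S = "{cut_norm (M - P * N * Q) | P Q. P \<in> permutation_mats d \<and> Q \<in> permutation_mats e}"
  have "?S = (\<lambda>(P, Q). cut_norm (M - P * N * Q)) ` (permutation_mats d \<times> permutation_mats e)" by auto
  then have fin: "finite ?S" using finite_permutation_mats by simp
  have mem: "cut_norm (M - ?mat d \<pi> * N * ?mat e \<tau>) \<in> ?S" if "\<pi> permutes {..<d}" "\<tau> permutes {..<e}" for \<pi> \<tau>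
    using that unfolding permutation_mats_def by blast
  have def: "cut_distance_same_size M N = Min ?S"
    using M by (simp add: cut_distance_same_size_def)
  have "?S \<noteq> {}" using mem[OF permutes_id permutes_id] by blast
  then have "Min ?S \<in> ?S" using Min_in[OF fin] by blast
  then obtain \<pi> \<tau> where "\<pi> permutes {..<d}" and \<tau>: "\<tau> permutes {..<e}"
    and "cut_norm (M - ?mat d \<pi> * N * ?mat e \<tau>) = Min ?S"
    unfolding permutation_mats_def by force
  then have "\<pi> permutes {..<d} \<and> inv_into UNIV \<tau> permutes {..<e} \<and>
      rectangle_sums_bounded (\<lambda>i j. M $$ (i, j) - N $$ (\<pi> i, inv_into UNIV \<tau> j)) {..<d} {..<e}
        (cut_distance_same_size M N * (real d * real e))"
    using cut_norm_permuted_le_iff[OF M N pos, of \<pi> \<tau> "Min ?S"] permutes_inv[OF \<tau>] def by simp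
  then show "\<exists>\<pi> \<tau>. \<pi> permutes {..<d} \<and> \<tau> permutes {..<e} \<and>
      rectangle_sums_bounded (\<lambda>i j. M $$ (i, j) - N $$ (\<pi> i, \<tau> j)) {..<d} {..<e}
        (cut_distance_same_size M N * (real d * real e))" by blast
  show "cut_distance_same_size M N \<le> c" if "\<pi> permutes {..<d}" "\<tau> permutes {..<e}"
    "rectangle_sums_bounded (\<lambda>i j. M $$ (i, j) - N $$ (\<pi> i, \<tau> j)) {..<d} {..<e} (c * (real d * real e))" for \<pi> \<tau>
  proof -
    have "Min ?S \<le> cut_norm (M - ?mat d \<pi> * N * ?mat e (inv_into UNIV \<tau>))"
      using that permutes_inv by (intro Min_le[OF fin] mem)
    also have "\<dots> \<le> c"
      using that cut_norm_permuted_le_iff[OF M N pos that(1) permutes_inv[OF that(2)], of c]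
      by (simp add: permutes_inv_inv[OF that(2)])
    finally show ?thesis using def by simp
  qed
qed

lemma blowup_carrier: "M \<in> carrier_mat m n \<Longrightarrow> blowup M p q \<in> carrier_mat (m * p) (n * q)"
  by (auto simp: blowup_def kronecker_product_def all_ones_mat_def)

lemma blowup_index:
  assumes "M \<in> carrier_mat m n" and "i < m * p" and "j < n * q"
  shows "blowup M p q $$ (i, j) = M $$ (i div p, j div q)"
proof -
  have "p > 0" "q > 0" using assms(2,3) by (auto intro: Nat.gr0I)
  then show ?thesis
    using assms by (simp add: blowup_def kronecker_product_def all_ones_mat_def)
qed

lemma rectangle_sums_bounded_reindex:
  assumes h: "bij_betw h D D'" and h': "bij_betw h' F F'"
    and rect: "rectangle_sums_bounded (\<lambda>x y. E (h x) (h' y)) D F C"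
  shows "rectangle_sums_bounded E D' F' C"
  unfolding rectangle_sums_bounded_def
proof (intro allI impI)
  fix X Y assume X: "X \<subseteq> D'" and Y: "Y \<subseteq> F'"
  let ?X = "{x \<in> D. h x \<in> X}" and ?Y = "{y \<in> F. h' y \<in> Y}"
  have bX: "bij_betw h ?X X" and bY: "bij_betw h' ?Y Y"
    using h h' X Y unfolding bij_betw_def by (auto intro: inj_on_subset)
  have "(\<Sum>x\<in>X. \<Sum>y\<in>Y. E x y) = (\<Sum>x\<in>?X. \<Sum>y\<in>?Y. E (h x) (h' y))"
    by (simp only: sum.reindex_bij_betw[OF bX, symmetric] sum.reindex_bij_betw[OF bY, symmetric])
  moreover have "?X \<subseteq> D" "?Y \<subseteq> F" by auto
  ultimately show "cmod (\<Sum>x\<in>X. \<Sum>y\<in>Y. E x y) \<le> C"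
    using rect unfolding rectangle_sums_bounded_def by simp
qed

lemma rectangle_sums_bounded_entries:
  assumes "finite D" and "finite F" and "c \<ge> 0"
    and "\<And>x y. x \<in> D \<Longrightarrow> y \<in> F \<Longrightarrow> cmod (E x y) \<le> c"
  shows "rectangle_sums_bounded E D F (c * (real (card D) * real (card F)))"
  unfolding rectangle_sums_bounded_def
proof (intro allI impI)
  fix X Y assume X: "X \<subseteq> D" and Y: "Y \<subseteq> F"
  have "cmod (\<Sum>x\<in>X. \<Sum>y\<in>Y. E x y) \<le> (\<Sum>x\<in>X. \<Sum>y\<in>Y. c)"
    using X Y assms(4) by (intro sum_norm_le) (blast intro: sum_norm_le)
  also have "\<dots> = c * (real (card X) * real (card Y))" by simp
  also have "\<dots> \<le> c * (real (card D) * real (card F))"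
    using assms(1-3) X Y by (intro mult_left_mono mult_mono) (auto simp: card_mono)
  finally show "cmod (\<Sum>x\<in>X. \<Sum>y\<in>Y. E x y) \<le> c * (real (card D) * real (card F))" .
qed

text \<open>
  A rectangle in a block matrix cuts a rectangle out of every block.
\<close>
lemma rectangle_sums_bounded_Sigma:
  assumes I: "finite I" "\<And>u. u \<in> I \<Longrightarrow> finite (D u)" and J: "finite J" "\<And>w. w \<in> J \<Longrightarrow> finite (F w)"
    and blocks: "\<And>u w. u \<in> I \<Longrightarrow> w \<in> J \<Longrightarrow>
      rectangle_sums_bounded (\<lambda>x y. E (u, x) (w, y)) (D u) (F w) (C u w)"
  shows "rectangle_sums_bounded E (Sigma I D) (Sigma J F) (\<Sum>u\<in>I. \<Sum>w\<in>J. C u w)"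
  unfolding rectangle_sums_bounded_def
proof (intro allI impI)
  fix X Y assume X: "X \<subseteq> Sigma I D" and Y: "Y \<subseteq> Sigma J F"
  have sum_X: "(\<Sum>z\<in>X. f z) = (\<Sum>u\<in>I. \<Sum>x\<in>{x \<in> D u. (u, x) \<in> X}. f (u, x))" for f :: "_ \<Rightarrow> complex"
  proof -
    have "X = Sigma I (\<lambda>u. {x \<in> D u. (u, x) \<in> X})" using X by auto
    then have "(\<Sum>z\<in>X. f z) = (\<Sum>z\<in>Sigma I (\<lambda>u. {x \<in> D u. (u, x) \<in> X}). f z)"
      by (rule arg_cong[where f = "sum f"])
    also have "\<dots> = (\<Sum>u\<in>I. \<Sum>x\<in>{x \<in> D u. (u, x) \<in> X}. f (u, x))"
      using I by (subst sum.Sigma) auto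
    finally show ?thesis .
  qed
  have sum_Y: "(\<Sum>z\<in>Y. f z) = (\<Sum>w\<in>J. \<Sum>y\<in>{y \<in> F w. (w, y) \<in> Y}. f (w, y))" for f :: "_ \<Rightarrow> complex"
  proof -
    have "Y = Sigma J (\<lambda>w. {y \<in> F w. (w, y) \<in> Y})" using Y by auto
    then have "(\<Sum>z\<in>Y. f z) = (\<Sum>z\<in>Sigma J (\<lambda>w. {y \<in> F w. (w, y) \<in> Y}). f z)"
      by (rule arg_cong[where f = "sum f"])
    also have "\<dots> = (\<Sum>w\<in>J. \<Sum>y\<in>{y \<in> F w. (w, y) \<in> Y}. f (w, y))"
      using J by (subst sum.Sigma) auto
    finally show ?thesis .
  qed
  have "(\<Sum>z\<in>X. \<Sum>z'\<in>Y. E z z') =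
      (\<Sum>u\<in>I. \<Sum>x\<in>{x \<in> D u. (u, x) \<in> X}. \<Sum>w\<in>J. \<Sum>y\<in>{y \<in> F w. (w, y) \<in> Y}. E (u, x) (w, y))"
    by (simp only: sum_X sum_Y)
  also have "\<dots> = (\<Sum>u\<in>I. \<Sum>w\<in>J. \<Sum>x\<in>{x \<in> D u. (u, x) \<in> X}. \<Sum>y\<in>{y \<in> F w. (w, y) \<in> Y}. E (u, x) (w, y))"
    by (intro sum.cong refl sum.swap)
  also have "cmod \<dots> \<le> (\<Sum>u\<in>I. \<Sum>w\<in>J. C u w)"
  proof (intro sum_norm_le)
    fix u w assume "u \<in> I" "w \<in> J"
    from blocks[OF this] show "cmod (\<Sum>x\<in>{x \<in> D u. (u, x) \<in> X}. \<Sum>y\<in>{y \<in> F w. (w, y) \<in> Y}. E (u, x) (w, y)) \<le> C u w"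
      by (rule rectangle_sums_boundedD) auto
  qed
  finally show "cmod (\<Sum>z\<in>X. \<Sum>z'\<in>Y. E z z') \<le> (\<Sum>u\<in>I. \<Sum>w\<in>J. C u w)" .
qed

text \<open>
  Two numberings of the same set differ by a permutation of the numbers, so that a coupling determines
  a permutation.
\<close>
lemma permutation_between_enumerations:
  assumes "bij_betw h D N" and "bij_betw h' D N"
  shows "\<exists>\<pi>. \<pi> permutes N \<and> (\<forall>x\<in>D. \<pi> (h x) = h' x)"
proof -
  define \<pi> where "\<pi> = (\<lambda>i. if i \<in> N then h' (inv_into D h i) else i)"
  have "bij_betw (h' \<circ> inv_into D h) N N"
    using bij_betw_trans[OF bij_betw_inv_into[OF assms(1)] assms(2)] .
  then have "bij_betw \<pi> N N"
    by (rule bij_betw_cong[THEN iffD1, rotated]) (simp add: \<pi>_def)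
  then have "\<pi> permutes N" by (rule bij_imp_permutes) (simp add: \<pi>_def)
  moreover have "\<pi> (h x) = h' x" if "x \<in> D" for x
    using that assms(1) by (auto simp: \<pi>_def bij_betw_def)
  ultimately show ?thesis by blast
qed

section \<open>Blow-up distances are realized by couplings\<close>

text \<open>
  The fibre sizes are those of the \<open>k\<close>-th blow-ups in the definition of the cut-distance, and \<open>c\<close>
  bounds the cut norm of the difference of the two matrices pulled back to \<open>D\<close> and \<open>F\<close>.
\<close>
definition coupled :: "complex mat \<Rightarrow> complex mat \<Rightarrow> nat \<Rightarrow> real \<Rightarrow> 'a set \<Rightarrow> 'b set \<Rightarrow>
    ('a \<Rightarrow> nat) \<Rightarrow> ('a \<Rightarrow> nat) \<Rightarrow> ('b \<Rightarrow> nat) \<Rightarrow> ('b \<Rightarrow> nat) \<Rightarrow> bool" where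
  "coupled A B k c D F a b a' b' \<longleftrightarrow>
     equitable D a (dim_row A) (k * dim_row B) \<and> equitable D b (dim_row B) (k * dim_row A) \<and>
     equitable F a' (dim_col A) (k * dim_col B) \<and> equitable F b' (dim_col B) (k * dim_col A) \<and>
     rectangle_sums_bounded (\<lambda>x y. A $$ (a x, a' y) - B $$ (b x, b' y)) D F
       (c * (real (card D) * real (card F)))"

text \<open>
  The sequence whose limit is the cut-distance.
\<close>
definition blowup_distance :: "complex mat \<Rightarrow> complex mat \<Rightarrow> nat \<Rightarrow> real" where
  "blowup_distance A B k = cut_distance_same_size
     (blowup A (k * dim_row B) (k * dim_col B)) (blowup B (k * dim_row A) (k * dim_col A))"

lemma coupled_card:
  assumes "coupled A B k c D F a b a' b'"
  shows "card D = dim_row A * (k * dim_row B)" and "card F = dim_col A * (k * dim_col B)"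
  using assms equitable_card by (auto simp: coupled_def)

lemma blowup_distance_attained:
  assumes A: "A \<in> carrier_mat m n" and B: "B \<in> carrier_mat r s"
    and pos: "m > 0" "n > 0" "r > 0" "s > 0" "k > 0"
  shows "\<exists>b b'. coupled A B k (blowup_distance A B k) {..<m * (k * r)} {..<n * (k * s)}
    (\<lambda>x. x div (k * r)) b (\<lambda>y. y div (k * s)) b'"
proof -
  let ?d = "m * (k * r)" and ?e = "n * (k * s)"
  have de: "?d = r * (k * m)" "?e = s * (k * n)" by simp_all
  have bA: "blowup A (k * r) (k * s) \<in> carrier_mat ?d ?e" by (rule blowup_carrier[OF A])
  have bB: "blowup B (k * m) (k * n) \<in> carrier_mat ?d ?e" unfolding de by (rule blowup_carrier[OF B])
  have dist: "blowup_distance A B k = cut_distance_same_size (blowup A (k * r) (k * s)) (blowup B (k * m) (k * n))"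
    using A B by (simp add: blowup_distance_def)
  obtain \<pi> \<tau> where \<pi>: "\<pi> permutes {..<?d}" and \<tau>: "\<tau> permutes {..<?e}"
    and rect: "rectangle_sums_bounded (\<lambda>i j. blowup A (k * r) (k * s) $$ (i, j) - blowup B (k * m) (k * n) $$ (\<pi> i, \<tau> j))
      {..<?d} {..<?e} (blowup_distance A B k * (real ?d * real ?e))"
    using cut_distance_same_size_attained[OF bA bB] pos unfolding dist by auto
  have "blowup A (k * r) (k * s) $$ (i, j) - blowup B (k * m) (k * n) $$ (\<pi> i, \<tau> j) =
      A $$ (i div (k * r), j div (k * s)) - B $$ (\<pi> i div (k * m), \<tau> j div (k * n))"
    if "i \<in> {..<?d}" "j \<in> {..<?e}" for i j
  proof -
    have "\<pi> i < r * (k * m)" "\<tau> j < s * (k * n)"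
      using that permutes_in_image[OF \<pi>] permutes_in_image[OF \<tau>] unfolding de by blast+
    then show ?thesis using that blowup_index[OF A, of i "k * r" j "k * s"] blowup_index[OF B, of "\<pi> i" "k * m" "\<tau> j" "k * n"] by simp
  qed
  then have "rectangle_sums_bounded (\<lambda>i j. A $$ (i div (k * r), j div (k * s)) - B $$ (\<pi> i div (k * m), \<tau> j div (k * n)))
      {..<?d} {..<?e} (blowup_distance A B k * (real ?d * real ?e))"
    by (rule rectangle_sums_bounded_cong[THEN iffD1, OF _ rect])
  moreover have "equitable {..<?d} (\<lambda>x. \<pi> x div (k * m)) r (k * m)" "equitable {..<?e} (\<lambda>y. \<tau> y div (k * n)) s (k * n)"
    by (rule equitable_permute[OF equitable_div[OF de(1)] \<pi>], rule equitable_permute[OF equitable_div[OF de(2)] \<tau>])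
  ultimately have "coupled A B k (blowup_distance A B k) {..<?d} {..<?e}
    (\<lambda>x. x div (k * r)) (\<lambda>x. \<pi> x div (k * m)) (\<lambda>y. y div (k * s)) (\<lambda>y. \<tau> y div (k * n))"
    unfolding coupled_def using A B equitable_div[of ?d m "k * r"] equitable_div[of ?e n "k * s"]
    by (simp only: carrier_matD card_lessThan)
  then show ?thesis by blast
qed

lemma blowup_distance_le:
  assumes A: "A \<in> carrier_mat m n" and B: "B \<in> carrier_mat r s"
    and pos: "m > 0" "n > 0" "r > 0" "s > 0" "k > 0"
    and coupled: "coupled A B k c D F a b a' b'"
  shows "blowup_distance A B k \<le> c"
proof -
  let ?d = "m * (k * r)" and ?e = "n * (k * s)"
  have de: "?d = r * (k * m)" "?e = s * (k * n)" by simp_all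
  have bA: "blowup A (k * r) (k * s) \<in> carrier_mat ?d ?e" by (rule blowup_carrier[OF A])
  have bB: "blowup B (k * m) (k * n) \<in> carrier_mat ?d ?e" unfolding de by (rule blowup_carrier[OF B])
  have dist: "blowup_distance A B k = cut_distance_same_size (blowup A (k * r) (k * s)) (blowup B (k * m) (k * n))"
    using A B by (simp add: blowup_distance_def)
  have eq: "equitable D a m (k * r)" "equitable D b r (k * m)" "equitable F a' n (k * s)" "equitable F b' s (k * n)"
    and rect: "rectangle_sums_bounded (\<lambda>x y. A $$ (a x, a' y) - B $$ (b x, b' y)) D F (c * (real ?d * real ?e))"
    using coupled coupled_card[OF coupled] A B by (simp_all add: coupled_def)
  obtain h where h: "bij_betw h D {..<?d}" "\<forall>x\<in>D. h x div (k * r) = a x"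
    using equitable_enumeration[OF eq(1)] by blast
  obtain g where g: "bij_betw g D {..<?d}" "\<forall>x\<in>D. g x div (k * m) = b x"
    using equitable_enumeration[OF eq(2)] unfolding de by blast
  obtain h' where h': "bij_betw h' F {..<?e}" "\<forall>y\<in>F. h' y div (k * s) = a' y"
    using equitable_enumeration[OF eq(3)] by blast
  obtain g' where g': "bij_betw g' F {..<?e}" "\<forall>y\<in>F. g' y div (k * n) = b' y"
    using equitable_enumeration[OF eq(4)] unfolding de by blast
  obtain \<pi> where \<pi>: "\<pi> permutes {..<?d}" "\<forall>x\<in>D. \<pi> (h x) = g x"
    using permutation_between_enumerations[OF h(1) g(1)] by blast
  obtain \<tau> where \<tau>: "\<tau> permutes {..<?e}" "\<forall>y\<in>F. \<tau> (h' y) = g' y"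
    using permutation_between_enumerations[OF h'(1) g'(1)] by blast
  have "rectangle_sums_bounded (\<lambda>x y. blowup A (k * r) (k * s) $$ (h x, h' y) - blowup B (k * m) (k * n) $$ (\<pi> (h x), \<tau> (h' y)))
      D F (c * (real ?d * real ?e))"
  proof (rule rectangle_sums_bounded_cong[THEN iffD1, OF _ rect])
    fix x y assume xy: "x \<in> D" "y \<in> F"
    have "h x < ?d" "g x < r * (k * m)" "h' y < ?e" "g' y < s * (k * n)"
      using bij_betwE[OF h(1)] bij_betwE[OF g(1)] bij_betwE[OF h'(1)] bij_betwE[OF g'(1)] xy unfolding de by blast+
    then show "A $$ (a x, a' y) - B $$ (b x, b' y) =
        blowup A (k * r) (k * s) $$ (h x, h' y) - blowup B (k * m) (k * n) $$ (\<pi> (h x), \<tau> (h' y))"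
      using blowup_index[OF A, of "h x" "k * r" "h' y" "k * s"] blowup_index[OF B, of "g x" "k * m" "g' y" "k * n"]
        xy h(2) g(2) h'(2) g'(2) \<pi>(2) \<tau>(2) by simp
  qed
  then have "rectangle_sums_bounded (\<lambda>i j. blowup A (k * r) (k * s) $$ (i, j) - blowup B (k * m) (k * n) $$ (\<pi> i, \<tau> j))
      {..<?d} {..<?e} (c * (real ?d * real ?e))"
    by (rule rectangle_sums_bounded_reindex[OF h(1) h'(1)])
  then show ?thesis
    unfolding dist using pos by (intro cut_distance_same_size_le[OF bA bB _ _ \<pi>(1) \<tau>(1)]) simp_all
qed

text \<open>
  The empty rectangle has sum zero.
\<close>
lemma coupled_nonneg:
  assumes "coupled A B k c D F a b a' b'" and "D \<noteq> {}" "F \<noteq> {}"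
  shows "c \<ge> 0"
proof -
  have "0 \<le> c * (real (card D) * real (card F))"
    using assms(1) rectangle_sums_boundedD[of _ D F _ "{}" "{}"] by (fastforce simp: coupled_def)
  moreover have "finite D" "finite F"
    using assms(1) equitable_finite unfolding coupled_def by blast+
  then have "real (card D) * real (card F) > 0"
    using assms(2,3) by (simp add: card_gt_0_iff)
  ultimately show ?thesis by (meson mult_neg_pos not_le)
qed

lemma blowup_distance_nonneg:
  assumes A: "A \<in> carrier_mat m n" and B: "B \<in> carrier_mat r s"
    and pos: "m > 0" "n > 0" "r > 0" "s > 0" "k > 0"
  shows "blowup_distance A B k \<ge> 0"
proof -
  obtain b b' where "coupled A B k (blowup_distance A B k) {..<m * (k * r)} {..<n * (k * s)}
    (\<lambda>x. x div (k * r)) b (\<lambda>y. y div (k * s)) b'"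
    using blowup_distance_attained[OF assms] by blast
  then show ?thesis by (rule coupled_nonneg) (use pos in \<open>auto simp: lessThan_empty_iff\<close>)
qed

section \<open>Convergence of the blow-up distances\<close>

text \<open>
  Every value of the sequence is an upper bound, up to a vanishing error, for all late values; so the
  sequence converges to its infimum.
\<close>
lemma convergent_of_nearly_smallest:
  fixes f :: "nat \<Rightarrow> real"
  assumes nonneg: "\<And>k. k \<ge> 1 \<Longrightarrow> f k \<ge> 0"
    and step: "\<And>k0 k. k0 \<ge> 1 \<Longrightarrow> k \<ge> 1 \<Longrightarrow> f k \<le> f k0 + c * real k0 / real k"
  shows "convergent f"
proof -
  let ?L = "Inf (f ` {1..})"
  have bdd: "bdd_below (f ` {1..})" using nonneg by (intro bdd_belowI[of _ 0]) auto
  have "f \<longlonglongrightarrow> ?L"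
  proof (rule LIMSEQ_I)
    fix e :: real assume e: "e > 0"
    obtain k0 where k0: "k0 \<ge> 1" "f k0 < ?L + e / 2"
      using cInf_lessD[of "f ` {1..}" "?L + e / 2"] e by auto
    have "(\<lambda>k. c * real k0 / real k) \<longlonglongrightarrow> 0" by (rule lim_const_over_n)
    then obtain K where K: "\<And>k. k \<ge> K \<Longrightarrow> \<bar>c * real k0 / real k\<bar> < e / 2"
      using LIMSEQ_D[of "\<lambda>k. c * real k0 / real k" 0 "e / 2"] e by auto
    have "norm (f k - ?L) < e" if "k \<ge> max 1 K" for k
    proof -
      have k: "k \<ge> 1" "k \<ge> K" using that by auto
      have "?L \<le> f k" using that bdd by (intro cInf_lower) auto
      moreover have "f k < ?L + e" 
        using step[OF k0(1) k(1)] k0(2) K[OF k(2)] by linarith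
      ultimately show ?thesis by simp
    qed
    then show "\<exists>no. \<forall>k\<ge>no. norm (f k - ?L) < e" by blast
  qed
  then show ?thesis by (rule convergentI)
qed

text \<open>
  Here \<open>t\<close> is the proportion of rows, and of columns, that are covered by copies of a good coupling, so
  that a proportion \<open>t\<^sup>2\<close> of the entries has density at most \<open>\<delta>\<close>, and all others at most 2.
\<close>
lemma block_coupling_estimate:
  fixes \<delta> t x :: real
  assumes "\<delta> \<ge> 0" and "0 \<le> t" and "t \<le> 1" and "1 - t \<le> x"
  shows "2 + t\<^sup>2 * (\<delta> - 2) \<le> \<delta> + 4 * x"
proof -
  have "(1 - t) * (1 + t) \<le> (1 - t) * 2" "t\<^sup>2 \<le> 1"
    using assms(2,3) by (intro mult_left_mono, simp_all add: power_le_one)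
  then have t2: "t\<^sup>2 \<le> 1" "1 - t\<^sup>2 \<le> 2 * (1 - t)"
    by (simp_all add: power2_eq_square algebra_simps)
  have "(2 - \<delta>) * (1 - t\<^sup>2) \<le> 2 * (1 - t\<^sup>2)"
    using assms(1) t2(1) by (intro mult_right_mono) auto
  moreover have "2 + t\<^sup>2 * (\<delta> - 2) = \<delta> + (2 - \<delta>) * (1 - t\<^sup>2)"
    by (simp add: algebra_simps)
  ultimately have "2 + t\<^sup>2 * (\<delta> - 2) \<le> \<delta> + 2 * (1 - t\<^sup>2)" by simp
  also have "2 * (1 - t\<^sup>2) \<le> 4 * x" using t2(2) assms(4) by simp
  finally show ?thesis by simp
qed

text \<open>
  The row set and the column set consist of \<open>q\<close> copies of those of an optimal coupling of level \<open>k0\<close>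
  and one remainder of level \<open>\<rho>\<close>, coupled arbitrarily. A block between two copies inherits the bound
  of the optimal coupling, whichever copies they are. In the blocks that meet the remainder the
  entries are bounded by 2.
\<close>
lemma blowup_distance_step:
  assumes A: "A \<in> carrier_mat m n" and B: "B \<in> carrier_mat r s"
    and pos: "m > 0" "n > 0" "r > 0" "s > 0" "k0 > 0" "k > 0"
    and entries: "\<And>i j. i < m \<Longrightarrow> j < n \<Longrightarrow> cmod (A $$ (i, j)) \<le> 1"
      "\<And>i j. i < r \<Longrightarrow> j < s \<Longrightarrow> cmod (B $$ (i, j)) \<le> 1"
  shows "blowup_distance A B k \<le> blowup_distance A B k0 + 4 * real k0 / real k"
proof -
  let ?\<delta> = "blowup_distance A B k0"
  define q \<rho> where "q = k div k0" and "\<rho> = k mod k0"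
  have k: "k = q * k0 + \<rho>" and \<rho>: "\<rho> < k0" using pos by (simp_all add: q_def \<rho>_def)
  obtain b b' where coupled0: "coupled A B k0 ?\<delta> {..<m * (k0 * r)} {..<n * (k0 * s)}
    (\<lambda>x. x div (k0 * r)) b (\<lambda>y. y div (k0 * s)) b'"
    using blowup_distance_attained[OF A B pos(1-5)] by blast
  \<comment> \<open>The level of the \<open>u\<close>-th part; the index \<open>q\<close> stands for the remainder.\<close>
  define \<kappa> where "\<kappa> = (\<lambda>u. if u < q then k0 else \<rho>)"
  have sum_\<kappa>: "(\<Sum>u\<le>q. \<kappa> u) = k"
    unfolding lessThan_Suc_atMost[symmetric] by (simp add: \<kappa>_def k)
  define D F where "D = (\<lambda>u. {..<m * (\<kappa> u * r)})" and "F = (\<lambda>u. {..<n * (\<kappa> u * s)})"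
  define a where "a = (\<lambda>u x. x div (\<kappa> u * r))"
  define a' where "a' = (\<lambda>u y. y div (\<kappa> u * s))"
  define bb where "bb = (\<lambda>u x. if u < q then b x else x div (\<kappa> u * m))"
  define bb' where "bb' = (\<lambda>u y. if u < q then b' y else y div (\<kappa> u * n))"
  have eqs: "equitable (D u) (a u) m (\<kappa> u * r)" "equitable (F u) (a' u) n (\<kappa> u * s)"
    "equitable (D u) (bb u) r (\<kappa> u * m)" "equitable (F u) (bb' u) s (\<kappa> u * n)" for u
  proof -
    show "equitable (D u) (a u) m (\<kappa> u * r)" unfolding D_def a_def by (rule equitable_div) simp
    show "equitable (F u) (a' u) n (\<kappa> u * s)" unfolding F_def a'_def by (rule equitable_div) simp
    show "equitable (D u) (bb u) r (\<kappa> u * m)"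
      using coupled0 A B equitable_div[of "m * (\<rho> * r)" r "\<rho> * m"]
      by (cases "u < q") (simp_all add: D_def bb_def \<kappa>_def coupled_def)
    show "equitable (F u) (bb' u) s (\<kappa> u * n)"
      using coupled0 A B equitable_div[of "n * (\<rho> * s)" s "\<rho> * n"]
      by (cases "u < q") (simp_all add: F_def bb'_def \<kappa>_def coupled_def)
  qed
  let ?a = "\<lambda>(u, x). a u x" and ?b = "\<lambda>(u, x). bb u x" and ?a' = "\<lambda>(u, y). a' u y" and ?b' = "\<lambda>(u, y). bb' u y"
  let ?D = "Sigma {..q} D" and ?F = "Sigma {..q} F"
  have eq: "equitable ?D ?a m (k * r)" "equitable ?D ?b r (k * m)" "equitable ?F ?a' n (k * s)" "equitable ?F ?b' s (k * n)"
    using equitable_Sigma[of "{..q}" D a m "\<lambda>u. \<kappa> u * r"] equitable_Sigma[of "{..q}" D bb r "\<lambda>u. \<kappa> u * m"]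
      equitable_Sigma[of "{..q}" F a' n "\<lambda>u. \<kappa> u * s"] equitable_Sigma[of "{..q}" F bb' s "\<lambda>u. \<kappa> u * n"] eqs
    by (simp_all add: sum_distrib_right[symmetric] sum_\<kappa>)
  define E where "E = (\<lambda>u x w y. A $$ (a u x, a' w y) - B $$ (bb u x, bb' w y))"
  define C where "C = (\<lambda>u w. 2 * (real (card (D u)) * real (card (F w))) +
    (if u < q \<and> w < q then (?\<delta> - 2) * (real (m * (k0 * r)) * real (n * (k0 * s))) else 0))"
  have blocks: "rectangle_sums_bounded (\<lambda>x y. E u x w y) (D u) (F w) (C u w)" for u w
  proof (cases "u < q \<and> w < q")
    case True
    then have "C u w = ?\<delta> * (real (m * (k0 * r)) * real (n * (k0 * s)))"
      by (simp add: C_def D_def F_def \<kappa>_def algebra_simps)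
    moreover have "rectangle_sums_bounded (\<lambda>x y. E u x w y) (D u) (F w) (?\<delta> * (real (m * (k0 * r)) * real (n * (k0 * s))))"
      using coupled0 True by (simp add: coupled_def E_def D_def F_def a_def a'_def bb_def bb'_def \<kappa>_def)
    ultimately show ?thesis by simp
  next
    case False
    have "cmod (E u x w y) \<le> 2" if "x \<in> D u" "y \<in> F w" for x y
    proof -
      have "cmod (A $$ (a u x, a' w y)) \<le> 1" "cmod (B $$ (bb u x, bb' w y)) \<le> 1"
        using entries equitable_less[OF eqs(1) that(1)] equitable_less[OF eqs(2) that(2)]
          equitable_less[OF eqs(3) that(1)] equitable_less[OF eqs(4) that(2)] by simp_all
      then show ?thesis
        using norm_triangle_ineq4[of "A $$ (a u x, a' w y)" "B $$ (bb u x, bb' w y)"] by (simp add: E_def)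
    qed
    then have "rectangle_sums_bounded (\<lambda>x y. E u x w y) (D u) (F w) (2 * (real (card (D u)) * real (card (F w))))"
      by (intro rectangle_sums_bounded_entries) (simp_all add: D_def F_def)
    moreover have "C u w = 2 * (real (card (D u)) * real (card (F w)))" using False by (auto simp: C_def)
    ultimately show ?thesis by simp
  qed
  have rect: "rectangle_sums_bounded (\<lambda>z z'. A $$ (?a z, ?a' z') - B $$ (?b z, ?b' z')) ?D ?F (\<Sum>u\<le>q. \<Sum>w\<le>q. C u w)"
    by (rule rectangle_sums_bounded_Sigma) (use blocks in \<open>simp_all add: E_def D_def F_def\<close>)
  define t where "t = real (q * k0) / real k"
  let ?N = "real (card ?D) * real (card ?F)"
  have cards: "card ?D = m * (k * r)" "card ?F = n * (k * s)"
    using equitable_card[OF eq(1)] equitable_card[OF eq(3)] by simp_all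
  have "(\<Sum>u\<le>q. \<Sum>w\<le>q. C u w) = (\<Sum>u\<le>q. \<Sum>w\<le>q. 2 * (real (card (D u)) * real (card (F w)))) +
      (\<Sum>u\<le>q. \<Sum>w\<le>q. if u < q \<and> w < q then (?\<delta> - 2) * (real (m * (k0 * r)) * real (n * (k0 * s))) else 0)"
    by (simp add: C_def sum.distrib)
  also have "(\<Sum>u\<le>q. \<Sum>w\<le>q. 2 * (real (card (D u)) * real (card (F w)))) = 2 * ((\<Sum>u\<le>q. real (card (D u))) * (\<Sum>w\<le>q. real (card (F w))))"
    by (subst sum_product) (simp only: sum_distrib_left)
  also have "(\<Sum>u\<le>q. real (card (D u))) = card ?D" by (simp add: D_def)
  also have "(\<Sum>w\<le>q. real (card (F w))) = card ?F" by (simp add: F_def)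
  also have "(\<Sum>u\<le>q. \<Sum>w\<le>q. if u < q \<and> w < q then (?\<delta> - 2) * (real (m * (k0 * r)) * real (n * (k0 * s))) else 0)
      = real q * real q * ((?\<delta> - 2) * (real (m * (k0 * r)) * real (n * (k0 * s))))"
    unfolding lessThan_Suc_atMost[symmetric] by simp
  also have "\<dots> = t\<^sup>2 * (?\<delta> - 2) * ?N"
    unfolding cards t_def using pos by (simp add: power2_eq_square field_simps)
  also have "2 * (real (card ?D) * real (card ?F)) + t\<^sup>2 * (?\<delta> - 2) * ?N = (2 + t\<^sup>2 * (?\<delta> - 2)) * ?N"
    by (simp add: algebra_simps)
  finally have total: "(\<Sum>u\<le>q. \<Sum>w\<le>q. C u w) = (2 + t\<^sup>2 * (?\<delta> - 2)) * ?N" .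
  have "coupled A B k (2 + t\<^sup>2 * (?\<delta> - 2)) ?D ?F ?a ?b ?a' ?b'"
    unfolding coupled_def using eq rect A B by (simp only: carrier_matD total)
  then have "blowup_distance A B k \<le> 2 + t\<^sup>2 * (?\<delta> - 2)"
    by (rule blowup_distance_le[OF A B pos(1-4,6)])
  also have "\<dots> \<le> ?\<delta> + 4 * (real k0 / real k)"
  proof (rule block_coupling_estimate)
    show "?\<delta> \<ge> 0" by (rule blowup_distance_nonneg[OF A B pos(1-5)])
    show "0 \<le> t" by (simp add: t_def)
    have "real (q * k0) \<le> real k" by (simp add: k)
    then show "t \<le> 1" using pos by (simp add: t_def)
    have "real k - real (q * k0) \<le> real k0" using k \<rho> by simp
    moreover have "1 - t = (real k - real (q * k0)) / real k"
      using pos by (simp add: t_def diff_divide_distrib)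
    ultimately show "1 - t \<le> real k0 / real k" by (simp only: divide_right_mono of_nat_0_le_iff)
  qed
  finally show ?thesis by simp
qed

section \<open>The bound in terms of the cut-distance\<close>

lemma cmod_le_max_modulus:
  assumes "M \<in> carrier_mat m n" and "i < m" and "j < n"
  shows "cmod (M $$ (i, j)) \<le> max_modulus M"
  proof -
  have "finite (elements_mat M)" by (simp add: elements_mat_def)
  moreover have "M $$ (i, j) \<in> elements_mat M" using assms by (intro elements_matI) auto
  ultimately show ?thesis unfolding max_modulus_def by (intro Max_ge) auto
qed

theorem theorem7:
  fixes A B :: "complex mat" and m n r s :: nat
  assumes "A \<in> carrier_mat m n" and "B \<in> carrier_mat r s"
    and "max_modulus A = 1" and "max_modulus B = 1"
  shows "\<forall>i \<in> {1..Min {m, n, r, s}}.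
    \<bar>singular_value i A / sqrt (real m * real n) - singular_value i B / sqrt (real r * real s)\<bar>
      \<le> 6 * sqrt (cut_distance A B)"
proof
  fix i assume i: "i \<in> {1..Min {m, n, r, s}}"
  then have le: "1 \<le> i" "i \<le> m" "i \<le> n" "i \<le> r" "i \<le> s" by auto
  then have pos: "m > 0" "n > 0" "r > 0" "s > 0" by linarith+
  note A = assms(1) and B = assms(2)
  have entries: "\<And>i j. i < m \<Longrightarrow> j < n \<Longrightarrow> cmod (A $$ (i, j)) \<le> 1"
    "\<And>i j. i < r \<Longrightarrow> j < s \<Longrightarrow> cmod (B $$ (i, j)) \<le> 1"
    using cmod_le_max_modulus[OF A] cmod_le_max_modulus[OF B] assms(3,4) by simp_all
  let ?gap = "\<bar>singular_value i A / sqrt (real m * real n) - singular_value i B / sqrt (real r * real s)\<bar>"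
  let ?\<delta> = "blowup_distance A B"
  have gap: "?gap \<le> sqrt (32 * ?\<delta> k)" if k: "k > 0" for k
  proof -
    obtain b b' where c: "coupled A B k (?\<delta> k) {..<m * (k * r)} {..<n * (k * s)}
      (\<lambda>x. x div (k * r)) b (\<lambda>y. y div (k * s)) b'"
      using blowup_distance_attained[OF A B pos k] by blast
    let ?D = "{..<m * (k * r)}" and ?F = "{..<n * (k * s)}"
    have eq: "equitable ?D (\<lambda>x. x div (k * r)) m (k * r)" "equitable ?D b r (k * m)"
      "equitable ?F (\<lambda>y. y div (k * s)) n (k * s)" "equitable ?F b' s (k * n)"
      and rect: "rectangle_sums_bounded (\<lambda>x y. A $$ (x div (k * r), y div (k * s)) - B $$ (b x, b' y)) ?D ?F
        (?\<delta> k * (real (card ?D) * real (card ?F)))"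
      using c A B unfolding coupled_def by simp_all
    have ne: "?D \<noteq> {}" "?F \<noteq> {}" using pos k by (auto simp: lessThan_empty_iff)
    show ?thesis
      unfolding singular_value_def
      by (rule coupling_singular_values[OF A B eq ne _ _ rect]) (use entries le in simp_all)
  qed
  have "convergent ?\<delta>"
  proof (rule convergent_of_nearly_smallest)
    show "?\<delta> k \<ge> 0" if "k \<ge> 1" for k
      using blowup_distance_nonneg[OF A B pos] that by simp
    show "?\<delta> k \<le> ?\<delta> k0 + 4 * real k0 / real k" if "k0 \<ge> 1" "k \<ge> 1" for k0 k
      using blowup_distance_step[OF A B pos _ _ entries] that by simp
  qed
  then have lim: "?\<delta> \<longlonglongrightarrow> cut_distance A B"
    unfolding convergent_LIMSEQ_iff cut_distance_def blowup_distance_def .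
  then have "(\<lambda>k. sqrt (32 * ?\<delta> k)) \<longlonglongrightarrow> sqrt (32 * cut_distance A B)"
    by (intro tendsto_intros)
  then have "?gap \<le> sqrt (32 * cut_distance A B)"
    by (rule LIMSEQ_le_const) (use gap in \<open>auto intro!: exI[of _ 1]\<close>)
  also have "\<dots> \<le> sqrt (36 * cut_distance A B)"
  proof -
    have "cut_distance A B \<ge> 0"
      by (rule LIMSEQ_le_const[OF lim]) (use blowup_distance_nonneg[OF A B pos] in \<open>auto intro!: exI[of _ 1]\<close>)
    then show ?thesis by simp
  qed
  also have "\<dots> = 6 * sqrt (cut_distance A B)"
    by (simp add: real_sqrt_mult)
  finally show "?gap \<le> 6 * sqrt (cut_distance A B)" .
qed

end
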